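(* Let $\mathcal M=(M,<,+,0,\ldots)$ be an o-minimal expansion of an ordered group. The following are equivalent: (1) there exists a definable bijection between a bounded interval and an unbounded interval; (2) $\mathcal M$ enjoys the definable Tietze extension property.
   Context: "Definable" means definable in $\mathcal M$ with parameters. $\mathcal M$ enjoys the definable Tietze extension property if for every $n\ge1$, every definable closed $A\subseteq M^n$ (in the product order topology) and every continuous definable $f:A\to M$ there is a definable continuous $F:M^n\to M$ extending $f$. *)

theory Defs
  imports "HOL-Analysis.Analysis"
begin

section \<open>First-order structures and definability with parameters\<close>

datatype 'f fo_term = Var nat | Fun 'f "'f fo_term list"

datatype ('f, 'r) fo_formula =
    Eq "'f fo_term" "'f fo_term"
  | Rel 'r "'f fo_term list"
  | Neg "('f, 'r) fo_formula"
  | Conj "('f, 'r) fo_formula" "('f, 'r) fo_formula"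
  | Exists nat "('f, 'r) fo_formula"

text \<open>The universe of a structure is the whole type \<^typ>\<open>'a\<close>. An interpretation only matters
  on argument lists of the length prescribed by the arity of the symbol.\<close>

record ('f, 'r, 'a) fo_structure =
  fun_arity :: "'f \<Rightarrow> nat"
  rel_arity :: "'r \<Rightarrow> nat"
  fun_interp :: "'f \<Rightarrow> 'a list \<Rightarrow> 'a"
  rel_interp :: "'r \<Rightarrow> 'a list \<Rightarrow> bool"

primrec wf_term :: "('f, 'r, 'a) fo_structure \<Rightarrow> 'f fo_term \<Rightarrow> bool" where
  "wf_term \<M> (Var i) = True"
| "wf_term \<M> (Fun f ts) = (length ts = fun_arity \<M> f \<and> list_all (wf_term \<M>) ts)"

primrec wf_formula :: "('f, 'r, 'a) fo_structure \<Rightarrow> ('f, 'r) fo_formula \<Rightarrow> bool" where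
  "wf_formula \<M> (Eq s t) = (wf_term \<M> s \<and> wf_term \<M> t)"
| "wf_formula \<M> (Rel r ts) = (length ts = rel_arity \<M> r \<and> list_all (wf_term \<M>) ts)"
| "wf_formula \<M> (Neg \<phi>) = wf_formula \<M> \<phi>"
| "wf_formula \<M> (Conj \<phi> \<psi>) = (wf_formula \<M> \<phi> \<and> wf_formula \<M> \<psi>)"
| "wf_formula \<M> (Exists i \<phi>) = wf_formula \<M> \<phi>"

primrec term_val :: "('f, 'r, 'a) fo_structure \<Rightarrow> (nat \<Rightarrow> 'a) \<Rightarrow> 'f fo_term \<Rightarrow> 'a" where
  "term_val \<M> e (Var i) = e i"
| "term_val \<M> e (Fun f ts) = fun_interp \<M> f (map (term_val \<M> e) ts)"

primrec sat :: "('f, 'r, 'a) fo_structure \<Rightarrow> (nat \<Rightarrow> 'a) \<Rightarrow> ('f, 'r) fo_formula \<Rightarrow> bool" where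
  "sat \<M> e (Eq s t) = (term_val \<M> e s = term_val \<M> e t)"
| "sat \<M> e (Rel r ts) = rel_interp \<M> r (map (term_val \<M> e) ts)"
| "sat \<M> e (Neg \<phi>) = (\<not> sat \<M> e \<phi>)"
| "sat \<M> e (Conj \<phi> \<psi>) = (sat \<M> e \<phi> \<and> sat \<M> e \<psi>)"
| "sat \<M> e (Exists i \<phi>) = (\<exists>a. sat \<M> (e(i := a)) \<phi>)"

text \<open>The Cartesian power \<open>M\<^sup>n\<close> is the set of extensional functions on \<open>{..<n}\<close>, which is the
  carrier of the library's product topology.\<close>

abbreviation cart_power :: "nat \<Rightarrow> (nat \<Rightarrow> 'a) set" where
  "cart_power n \<equiv> {..<n} \<rightarrow>\<^sub>E UNIV"

text \<open>The variables \<open>0, \<dots>, n - 1\<close> are the coordinates; the other free variables of the formula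
  (finitely many) are assigned the parameters by \<open>e\<close>.\<close>

definition definable :: "('f, 'r, 'a) fo_structure \<Rightarrow> nat \<Rightarrow> (nat \<Rightarrow> 'a) set \<Rightarrow> bool" where
  "definable \<M> n A \<longleftrightarrow>
     (\<exists>\<phi> e. wf_formula \<M> \<phi> \<and>
            A = {x \<in> cart_power n. sat \<M> (override_on e x {..<n}) \<phi>})"

text \<open>A map \<open>f : A \<rightarrow> M\<close> with \<open>A \<subseteq> M\<^sup>n\<close> is definable if its graph is a definable subset of
  \<open>M\<^sup>n\<^sup>+\<^sup>1\<close>. Values of \<open>f\<close> outside \<open>A\<close> are irrelevant.\<close>

definition definable_fun ::
  "('f, 'r, 'a) fo_structure \<Rightarrow> nat \<Rightarrow> (nat \<Rightarrow> 'a) set \<Rightarrow> ((nat \<Rightarrow> 'a) \<Rightarrow> 'a) \<Rightarrow> bool" where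
  "definable_fun \<M> n A f \<longleftrightarrow>
     definable \<M> (Suc n)
       {x \<in> cart_power (Suc n).
          restrict x {..<n} \<in> A \<and> x n = f (restrict x {..<n})}"

text \<open>The copy in \<open>M\<^sup>1\<close> of a subset of \<open>M\<close>.\<close>

definition line_set :: "'a set \<Rightarrow> (nat \<Rightarrow> 'a) set" where
  "line_set S = {x \<in> cart_power 1. x 0 \<in> S}"

section \<open>O-minimal expansions of ordered groups\<close>

text \<open>The group is not assumed to be commutative.\<close>

class linordered_group_add = group_add + linorder +
  assumes add_left_strict_mono_group: "a < b \<Longrightarrow> c + a < c + b"
    and add_right_strict_mono_group: "a < b \<Longrightarrow> a + c < b + c"

definition expands_ordered_group ::
  "('f, 'r, 'a::linordered_group_add) fo_structure \<Rightarrow> bool" where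
  "expands_ordered_group \<M> \<longleftrightarrow>
     (\<exists>r. rel_arity \<M> r = 2 \<and> (\<forall>a b. rel_interp \<M> r [a, b] \<longleftrightarrow> a < b)) \<and>
     (\<exists>f. fun_arity \<M> f = 2 \<and> (\<forall>a b. fun_interp \<M> f [a, b] = a + b)) \<and>
     (\<exists>c. fun_arity \<M> c = 0 \<and> fun_interp \<M> c [] = 0)"

definition open_interval :: "'a::linorder set \<Rightarrow> bool" where
  "open_interval I \<longleftrightarrow>
     (\<exists>a b. a < b \<and> I = {a<..<b}) \<or> (\<exists>a. I = {a<..}) \<or> (\<exists>b. I = {..<b}) \<or> I = UNIV"

text \<open>As usual, the underlying order of an o-minimal structure is dense without endpoints; this
  is expressed by the type classes.\<close>

definition o_minimal ::
  "('f, 'r, 'a::{dense_linorder, no_bot, no_top}) fo_structure \<Rightarrow> bool" where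
  "o_minimal \<M> \<longleftrightarrow>
     (\<forall>S. definable \<M> 1 (line_set S) \<longrightarrow>
        (\<exists>\<I>. finite \<I> \<and> (\<forall>I\<in>\<I>. open_interval I \<or> (\<exists>a. I = {a})) \<and> S = \<Union>\<I>))"

section \<open>The two properties\<close>

definition bounded_interval :: "'a::linorder set \<Rightarrow> bool" where
  "bounded_interval I \<longleftrightarrow>
     (\<exists>a b. a < b \<and> (I = {a<..<b} \<or> I = {a..<b} \<or> I = {a<..b} \<or> I = {a..b}))"

definition unbounded_interval :: "'a::linorder set \<Rightarrow> bool" where
  "unbounded_interval I \<longleftrightarrow>
     (\<exists>a. I = {a<..} \<or> I = {a..} \<or> I = {..<a} \<or> I = {..a}) \<or> I = UNIV"

definition definable_bij ::
  "('f, 'r, 'a) fo_structure \<Rightarrow> ('a \<Rightarrow> 'a) \<Rightarrow> 'a set \<Rightarrow> 'a set \<Rightarrow> bool" where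
  "definable_bij \<M> f I J \<longleftrightarrow>
     bij_betw f I J \<and> definable_fun \<M> 1 (line_set I) (\<lambda>x. f (x 0))"

text \<open>For a type of class \<^class>\<open>linorder_topology\<close>, \<open>euclidean\<close> is the order topology.\<close>

abbreviation cart_topology :: "nat \<Rightarrow> (nat \<Rightarrow> 'a::linorder_topology) topology" where
  "cart_topology n \<equiv> product_topology (\<lambda>_. euclidean) {..<n}"

definition definable_Tietze :: "('f, 'r, 'a::linorder_topology) fo_structure \<Rightarrow> bool" where
  "definable_Tietze \<M> \<longleftrightarrow>
     (\<forall>n\<ge>1. \<forall>A f.
        definable \<M> n A \<and> closedin (cart_topology n) A \<and>
        definable_fun \<M> n A f \<and>
        continuous_map (subtopology (cart_topology n) A) euclidean f \<longrightarrow>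
        (\<exists>F. definable_fun \<M> n (cart_power n) F \<and>
             continuous_map (cart_topology n) euclidean F \<and>
             (\<forall>x\<in>A. F x = f x)))"

end

theory Submission
  imports Defs
begin

text \<open>
  Call a definable decreasing bijection from some \<open>(0, e)\<close> onto \<open>(0, \<infinity>)\<close> a pole. A definable
  function that is unbounded on a bounded set yields a pole: at some point it tends to infinity from
  one side, and the size \<open>w t\<close> of the neighbourhood on which it exceeds \<open>t\<close> is monotone, so the
  suprema of the fibres of \<open>w\<close> form a strictly decreasing function with a pole. Hence the first
  condition of the theorem holds iff there is a pole.

  Given a pole \<open>\<tau>\<close> with inverse \<open>\<rho>\<close>, let \<open>\<Lambda> \<delta> t = \<delta> + \<rho> (\<tau> \<delta> + \<rho> t)\<close> for small \<open>\<delta>\<close>, so that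
  \<open>\<delta> < \<Lambda> \<delta> t < 2\<delta>\<close> and \<open>\<Lambda>\<close> is strictly increasing in \<open>t\<close>. A continuous definable function \<open>f \<ge> 0\<close> on
  a closed set \<open>A\<close> is extended to points \<open>x\<close> outside \<open>A\<close> by the infimum of all \<open>t > 0\<close> such that
  \<open>f a < t\<close> for some \<open>a \<in> A\<close> at distance less than \<open>\<Lambda> (d(x, A)) t\<close> from \<open>x\<close>. No compactness is
  needed: monotonicity of \<open>\<Lambda>\<close> in \<open>t\<close> and its continuity in \<open>\<delta>\<close> for each fixed \<open>t\<close> make the sub- and
  superlevel sets of the extension open.

  Conversely, extend the function that is \<open>0\<close> on \<open>M \<times> {0}\<close> and \<open>x\<close> at \<open>(x, u)\<close> to a continuous
  definable \<open>H\<close>. Without a pole, definable functions on \<open>[0, u]\<close> are bounded, so some \<open>c > 0\<close> is not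
  an eventual value of \<open>H(-, y)\<close> for any \<open>y \<in> [0, u]\<close>, and one \<open>x > c\<close> lies beyond the point where
  \<open>H(-, y)\<close> has decided on which side of \<open>c\<close> it stays, for all \<open>y\<close> at once. Then \<open>H(x, -)\<close> goes from \<open>0\<close>
  to \<open>x > c\<close> without taking the value \<open>c\<close>.
\<close>

section \<open>Definable predicates and terms\<close>

primrec rename_term :: "(nat \<Rightarrow> nat) \<Rightarrow> 'f fo_term \<Rightarrow> 'f fo_term" where
  "rename_term \<rho> (Var i) = Var (\<rho> i)"
| "rename_term \<rho> (Fun f ts) = Fun f (map (rename_term \<rho>) ts)"

primrec rename_formula :: "(nat \<Rightarrow> nat) \<Rightarrow> ('f, 'r) fo_formula \<Rightarrow> ('f, 'r) fo_formula" where
  "rename_formula \<rho> (Eq s t) = Eq (rename_term \<rho> s) (rename_term \<rho> t)"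
| "rename_formula \<rho> (Rel r ts) = Rel r (map (rename_term \<rho>) ts)"
| "rename_formula \<rho> (Neg \<phi>) = Neg (rename_formula \<rho> \<phi>)"
| "rename_formula \<rho> (Conj \<phi> \<psi>) = Conj (rename_formula \<rho> \<phi>) (rename_formula \<rho> \<psi>)"
| "rename_formula \<rho> (Exists i \<phi>) = Exists (\<rho> i) (rename_formula \<rho> \<phi>)"

primrec bound_vars :: "('f, 'r) fo_formula \<Rightarrow> nat set" where
  "bound_vars (Eq s t) = {}"
| "bound_vars (Rel r ts) = {}"
| "bound_vars (Neg \<phi>) = bound_vars \<phi>"
| "bound_vars (Conj \<phi> \<psi>) = bound_vars \<phi> \<union> bound_vars \<psi>"
| "bound_vars (Exists i \<phi>) = insert i (bound_vars \<phi>)"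

lemma wf_rename_term [simp]: "wf_term \<M> (rename_term \<rho> t) = wf_term \<M> t"
  by (induction t) (auto simp: list_all_iff)

lemma wf_rename_formula [simp]: "wf_formula \<M> (rename_formula \<rho> \<phi>) = wf_formula \<M> \<phi>"
  by (induction \<phi>) (auto simp: list_all_iff)

lemma bound_vars_rename [simp]: "bound_vars (rename_formula \<rho> \<phi>) = \<rho> ` bound_vars \<phi>"
  by (induction \<phi>) auto

lemma term_val_rename: "term_val \<M> e (rename_term \<rho> t) = term_val \<M> (\<lambda>k. e (\<rho> k)) t"
proof (induction t)
  case (Fun f ts)
  then have "map (term_val \<M> e) (map (rename_term \<rho>) ts) = map (term_val \<M> (\<lambda>k. e (\<rho> k))) ts"
    by auto
  then show ?case
    by (simp only: rename_term.simps term_val.simps)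
qed simp

text \<open>An update of the assignment at \<open>\<rho> i\<close> pulls back along
  \<open>\<rho>\<close> to an update at \<open>i\<close> alone as soon as no other variable is sent
  to \<open>\<rho> i\<close>. Only bound variables are protected in this way; free variables may be
  identified with one another.\<close>

lemma sat_rename:
  assumes "\<And>b k. b \<in> bound_vars \<phi> \<Longrightarrow> k \<noteq> b \<Longrightarrow> \<rho> k \<noteq> \<rho> b"
  shows "sat \<M> e (rename_formula \<rho> \<phi>) = sat \<M> (\<lambda>k. e (\<rho> k)) \<phi>"
  using assms
proof (induction \<phi> arbitrary: e)
  case (Eq s t)
  show ?case by (simp add: term_val_rename)
next
  case (Rel r ts)
  have "map (term_val \<M> e) (map (rename_term \<rho>) ts) = map (term_val \<M> (\<lambda>k. e (\<rho> k))) ts"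
    by (auto simp: term_val_rename)
  then show ?case
    by (simp only: rename_formula.simps sat.simps)
next
  case (Exists i \<phi>)
  have "(\<lambda>k. (e(\<rho> i := a)) (\<rho> k)) = (\<lambda>k. e (\<rho> k))(i := a)" for a
    using Exists.prems[of i] by (auto simp: fun_eq_iff)
  moreover have "sat \<M> e' (rename_formula \<rho> \<phi>) = sat \<M> (\<lambda>k. e' (\<rho> k)) \<phi>" for e'
    using Exists.prems by (intro Exists.IH) auto
  ultimately show ?case by simp
qed auto

text \<open>Even variables are the coordinates of a point; odd variables hold parameters or are bound,
  so that coordinates can be substituted without capture.\<close>

definition interleave :: "(nat \<Rightarrow> 'a) \<Rightarrow> (nat \<Rightarrow> 'a) \<Rightarrow> nat \<Rightarrow> 'a" where
  "interleave v e k = (if even k then v (k div 2) else e (k div 2))"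

lemma eq_interleaveI:
  assumes "\<And>k. f (2 * k) = v k" "\<And>k. f (Suc (2 * k)) = e k"
  shows "f = interleave v e"
proof
  fix k
  show "f k = interleave v e k"
  proof (cases "even k")
    case True
    then show ?thesis using assms(1)[of "k div 2"] by (simp add: interleave_def)
  next
    case False
    then show ?thesis using assms(2)[of "k div 2"] by (simp add: interleave_def)
  qed
qed

text \<open>A predicate on whole assignments has no dimension, so Boolean combinations, quantifiers
  and substitutions can be formed without counting coordinates.\<close>

definition definable_pred ::
    "('f, 'r, 'a) fo_structure \<Rightarrow> ((nat \<Rightarrow> 'a) \<Rightarrow> bool) \<Rightarrow> bool" where
  "definable_pred \<M> P \<longleftrightarrow>
     (\<exists>\<phi> e. wf_formula \<M> \<phi> \<and> (\<forall>b\<in>bound_vars \<phi>. odd b) \<and>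
            (\<forall>v. P v \<longleftrightarrow> sat \<M> (interleave v e) \<phi>))"

lemma definable_predI:
  assumes "wf_formula \<M> \<phi>" "\<And>b. b \<in> bound_vars \<phi> \<Longrightarrow> odd b"
    "\<And>v. P v \<longleftrightarrow> sat \<M> (interleave v e) \<phi>"
  shows "definable_pred \<M> P"
  using assms unfolding definable_pred_def by blast

lemma definable_predE:
  assumes "definable_pred \<M> P"
  obtains \<phi> e where "wf_formula \<M> \<phi>" "\<And>b. b \<in> bound_vars \<phi> \<Longrightarrow> odd b"
    "\<And>v. P v \<longleftrightarrow> sat \<M> (interleave v e) \<phi>"
  using assms unfolding definable_pred_def by blast

lemma definable_pred_subst:
  assumes "definable_pred \<M> P"
    and "\<And>k. (\<exists>j. \<forall>v. s v k = v j) \<or> (\<exists>c. \<forall>v. s v k = c)"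
  shows "definable_pred \<M> (\<lambda>v. P (s v))"
proof -
  obtain \<phi> e where \<phi>: "wf_formula \<M> \<phi>" "\<And>b. b \<in> bound_vars \<phi> \<Longrightarrow> odd b"
      "\<And>v. P v \<longleftrightarrow> sat \<M> (interleave v e) \<phi>"
    using definable_predE[OF assms(1)] by blast
  have "\<exists>x. \<forall>v. s v k = case_sum v id x" for k
    using assms(2)[of k]
  proof (elim disjE exE)
    fix j assume "\<forall>v. s v k = v j"
    then show ?thesis by (intro exI[of _ "Inl j"]) simp
  next
    fix c assume "\<forall>v. s v k = c"
    then show ?thesis by (intro exI[of _ "Inr c"]) simp
  qed
  then obtain \<sigma> where \<sigma>: "\<And>k v. s v k = case_sum v id (\<sigma> k)"
    by metis
  \<comment> \<open>A coordinate that becomes a constant turns into a parameter: it goes to a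
    variable congruent to 1 modulo 4, and the old odd variables go to those congruent to 3. The new
    parameters therefore interleave the constants with \<open>e\<close>.\<close>
  define \<rho> where "\<rho> k = (if even k then case \<sigma> (k div 2) of Inl j \<Rightarrow> 2 * j | Inr _ \<Rightarrow> 2 * k + 1
      else 2 * k + 1)" for k
  define e' where "e' = interleave (\<lambda>k. projr (\<sigma> k)) e"
  have eq: "(\<lambda>k. interleave v e' (\<rho> k)) = interleave (s v) e" for v
    by (rule eq_interleaveI) (simp_all add: interleave_def \<rho>_def e'_def \<sigma> split: sum.split)
  have inj: "\<rho> k \<noteq> \<rho> b" if "b \<in> bound_vars \<phi>" "k \<noteq> b" for b k
  proof -
    have "odd b" using that \<phi>(2) by auto
    then have "\<rho> b = 2 * b + 1" by (simp add: \<rho>_def)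
    moreover have "\<rho> k = 2 * k + 1 \<or> even (\<rho> k)" by (auto simp: \<rho>_def split: sum.split)
    ultimately show ?thesis using that(2) by auto
  qed
  show ?thesis
  proof (rule definable_predI)
    show "wf_formula \<M> (rename_formula \<rho> \<phi>)" using \<phi> by simp
    show "odd b" if "b \<in> bound_vars (rename_formula \<rho> \<phi>)" for b
      using that \<phi>(2) by (auto simp: \<rho>_def)
    show "P (s v) \<longleftrightarrow> sat \<M> (interleave v e') (rename_formula \<rho> \<phi>)" for v
      by (subst sat_rename[OF inj]) (auto simp: eq \<phi>(3))
  qed
qed

lemma definable_pred_Not: "definable_pred \<M> P \<Longrightarrow> definable_pred \<M> (\<lambda>v. \<not> P v)"
  unfolding definable_pred_def by (metis bound_vars.simps(3) sat.simps(3) wf_formula.simps(3))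

lemma definable_pred_conj:
  assumes "definable_pred \<M> P" "definable_pred \<M> Q"
  shows "definable_pred \<M> (\<lambda>v. P v \<and> Q v)"
proof -
  obtain \<phi> e where \<phi>: "wf_formula \<M> \<phi>" "\<And>b. b \<in> bound_vars \<phi> \<Longrightarrow> odd b"
      "\<And>v. P v \<longleftrightarrow> sat \<M> (interleave v e) \<phi>"
    using definable_predE[OF assms(1)] by blast
  obtain \<psi> e' where \<psi>: "wf_formula \<M> \<psi>" "\<And>b. b \<in> bound_vars \<psi> \<Longrightarrow> odd b"
      "\<And>v. Q v \<longleftrightarrow> sat \<M> (interleave v e') \<psi>"
    using definable_predE[OF assms(2)] by blast
  \<comment> \<open>The two formulas share their coordinates, but their odd variables are separated
    into the classes 1 and 3 modulo 4, so that neither parameters nor bound variables clash.\<close>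
  define \<rho> where "\<rho> k = (if even k then k else 2 * k - 1)" for k :: nat
  define \<rho>' where "\<rho>' k = (if even k then k else 2 * k + 1)" for k :: nat
  have eq: "(\<lambda>k. interleave v (interleave e e') (\<rho> k)) = interleave v e" for v
    by (rule eq_interleaveI) (simp_all add: interleave_def \<rho>_def)
  have eq': "(\<lambda>k. interleave v (interleave e e') (\<rho>' k)) = interleave v e'" for v
    by (rule eq_interleaveI) (simp_all add: interleave_def \<rho>'_def)
  have inj: "\<rho> k \<noteq> \<rho> b" "\<rho>' k \<noteq> \<rho>' b" if "k \<noteq> b" for k b
    using that by (auto simp: \<rho>_def \<rho>'_def elim!: oddE; presburger)+
  have odd: "odd (\<rho> b)" "odd (\<rho>' b)" if "odd b" for b
    using that by (auto simp: \<rho>_def \<rho>'_def elim!: oddE)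
  show ?thesis
  proof (rule definable_predI)
    show "wf_formula \<M> (Conj (rename_formula \<rho> \<phi>) (rename_formula \<rho>' \<psi>))"
      using \<phi>(1) \<psi>(1) by simp
    show "odd b" if "b \<in> bound_vars (Conj (rename_formula \<rho> \<phi>) (rename_formula \<rho>' \<psi>))" for b
      using that \<phi>(2) \<psi>(2) odd by auto
    show "P v \<and> Q v \<longleftrightarrow> sat \<M> (interleave v (interleave e e'))
        (Conj (rename_formula \<rho> \<phi>) (rename_formula \<rho>' \<psi>))" for v
      unfolding sat.simps \<phi>(3) \<psi>(3)
      by (subst (1 2) sat_rename) (simp_all only: eq eq' inj not_False_eq_True)
  qed
qed

text \<open>As with de Bruijn indices, the quantified value is coordinate \<open>0\<close> and all
  other coordinates are shifted by one.\<close>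

lemma definable_pred_ex:
  assumes "definable_pred \<M> (\<lambda>v. P (\<lambda>k. v (Suc k)) (v 0))"
  shows "definable_pred \<M> (\<lambda>v. \<exists>a. P v a)"
proof -
  obtain \<phi> e where \<phi>: "wf_formula \<M> \<phi>" "\<And>b. b \<in> bound_vars \<phi> \<Longrightarrow> odd b"
      "\<And>v. P (\<lambda>k. v (Suc k)) (v 0) \<longleftrightarrow> sat \<M> (interleave v e) \<phi>"
    using definable_predE[OF assms(1)] by blast
  \<comment> \<open>Coordinate \<open>0\<close> becomes the bound variable \<open>1\<close>. The
    other even variables move down by 2 and the odd ones up by 2, which vacates that place.\<close>
  define \<rho> where "\<rho> k = (if k = 0 then 1 else if even k then k - 2 else k + 2)" for k :: nat
  define e' where "e' k = e (k - 1)" for k :: nat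
  have eq: "(\<lambda>k. ((interleave v e')(\<rho> 0 := a)) (\<rho> k)) = interleave (case_nat a v) e" for v a
    by (rule eq_interleaveI) (simp_all add: interleave_def \<rho>_def e'_def split: nat.split)
  have inj: "\<rho> k \<noteq> \<rho> b" if "k \<noteq> b" for k b
    using that unfolding \<rho>_def by presburger
  have P: "P v a \<longleftrightarrow> sat \<M> (interleave (case_nat a v) e) \<phi>" for v a
    using \<phi>(3)[of "case_nat a v"] by simp
  have odd: "odd (\<rho> b)" if "b = 0 \<or> odd b" for b
    using that by (auto simp: \<rho>_def)
  show ?thesis
  proof (rule definable_predI)
    show "wf_formula \<M> (Exists (\<rho> 0) (rename_formula \<rho> \<phi>))"
      using \<phi>(1) by simp
    show "odd b" if "b \<in> bound_vars (Exists (\<rho> 0) (rename_formula \<rho> \<phi>))" for b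
      using that \<phi>(2) odd by auto
    show "(\<exists>a. P v a) \<longleftrightarrow> sat \<M> (interleave v e') (Exists (\<rho> 0) (rename_formula \<rho> \<phi>))" for v
      unfolding sat.simps P
      by (subst sat_rename) (simp_all only: eq inj not_False_eq_True)
  qed
qed

lemma definable_pred_shift:
  assumes "definable_pred \<M> P"
  shows "definable_pred \<M> (\<lambda>v. P (\<lambda>k. v (\<sigma> k)))"
  by (rule definable_pred_subst[OF assms]) auto

lemma definable_pred_all:
  assumes "definable_pred \<M> (\<lambda>v. P (\<lambda>k. v (Suc k)) (v 0))"
  shows "definable_pred \<M> (\<lambda>v. \<forall>a. P v a)"
  using definable_pred_Not[OF definable_pred_ex[of \<M> "\<lambda>v a. \<not> P v a", OF definable_pred_Not[OF assms]]]
  by simp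

lemma definable_pred_disj:
  assumes "definable_pred \<M> P" "definable_pred \<M> Q"
  shows "definable_pred \<M> (\<lambda>v. P v \<or> Q v)"
  using definable_pred_Not[OF definable_pred_conj[OF assms[THEN definable_pred_Not]]] by simp

lemma definable_pred_imp:
  assumes "definable_pred \<M> P" "definable_pred \<M> Q"
  shows "definable_pred \<M> (\<lambda>v. P v \<longrightarrow> Q v)"
  using definable_pred_disj[OF definable_pred_Not[OF assms(1)] assms(2)]
  by (simp only: imp_conv_disj)

lemma definable_pred_const: "definable_pred \<M> (\<lambda>v. b)"
proof (cases b)
  case True
  then show ?thesis by (intro definable_predI[where \<phi> = "Eq (Var 0) (Var 0)"]) auto
next
  case False
  then show ?thesis by (intro definable_predI[where \<phi> = "Neg (Eq (Var 0) (Var 0))"]) auto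
qed

lemma definable_pred_all_less:
  assumes "\<And>i. i < (n::nat) \<Longrightarrow> definable_pred \<M> (\<lambda>v. P v i)"
  shows "definable_pred \<M> (\<lambda>v. \<forall>i<n. P v i)"
  using assms
proof (induction n)
  case 0
  show ?case by (simp add: definable_pred_const)
next
  case (Suc n)
  then have "definable_pred \<M> (\<lambda>v. P v n \<and> (\<forall>i<n. P v i))"
    by (intro definable_pred_conj) auto
  then show ?case by (simp add: All_less_Suc)
qed

text \<open>A quantifier over a point of \<open>M^n\<close> is \<open>n\<close> quantifiers over
  single coordinates. The induction works with one assignment in which the point is put in front of
  \<open>v\<close>.\<close>

lemma definable_pred_ex_cart:
  assumes "definable_pred \<M> (\<lambda>v. P (\<lambda>k. v (k + n)) (restrict v {..<n}))"
  shows "definable_pred \<M> (\<lambda>v. \<exists>a\<in>cart_power n. P v a)"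
proof -
  have *: "definable_pred \<M> (\<lambda>v. \<exists>a\<in>cart_power m. Q (\<lambda>k. if k < m then a k else v (k - m)))"
    if "definable_pred \<M> Q" for Q m
    using that
  proof (induction m arbitrary: Q)
    case 0
    then show ?case by simp
  next
    case (Suc m)
    \<comment> \<open>The last coordinate of the point is quantified away. It is inserted at
      position \<open>m\<close>, so everything behind it is read at \<open>k - 1\<close>.\<close>
    define Q' where "Q' w = (\<exists>b. Q (\<lambda>k. if k < m then w k else if k = m then b else w (k - 1)))" for w
    have "definable_pred \<M> Q'"
      unfolding Q'_def
    proof (rule definable_pred_ex)
      show "definable_pred \<M> (\<lambda>v. Q (\<lambda>k. if k < m then v (Suc k) else if k = m then v 0 else v (Suc (k - 1))))"
        by (rule definable_pred_subst[OF Suc.prems]) auto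
    qed
    from Suc.IH[OF this]
    have "definable_pred \<M> (\<lambda>v. \<exists>a\<in>cart_power m. Q' (\<lambda>k. if k < m then a k else v (k - m)))" .
    moreover have "(\<exists>a\<in>cart_power m. Q' (\<lambda>k. if k < m then a k else v (k - m))) \<longleftrightarrow>
        (\<exists>a\<in>cart_power (Suc m). Q (\<lambda>k. if k < Suc m then a k else v (k - Suc m)))" (is "?L \<longleftrightarrow> ?R") for v
    proof
      assume ?L
      then obtain a b where a: "a \<in> cart_power m"
        and Q: "Q (\<lambda>k. if k < m then if k < m then a k else v (k - m) else if k = m then b
                    else if k - 1 < m then a (k - 1) else v (k - 1 - m))"
        unfolding Q'_def by blast
      have "(\<lambda>k. if k < m then if k < m then a k else v (k - m) else if k = m then b
                    else if k - 1 < m then a (k - 1) else v (k - 1 - m)) =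
            (\<lambda>k. if k < Suc m then (a(m := b)) k else v (k - Suc m))"
        by (auto simp: fun_eq_iff)
      with Q show ?R
        using a by (intro bexI[of _ "a(m := b)"]) (auto simp: PiE_iff extensional_def)
    next
      assume ?R
      then obtain a where a: "a \<in> cart_power (Suc m)"
        and Q: "Q (\<lambda>k. if k < Suc m then a k else v (k - Suc m))"
        by blast
      have "(\<lambda>k. if k < Suc m then a k else v (k - Suc m)) =
        (\<lambda>k. if k < m then if k < m then (restrict a {..<m}) k else v (k - m) else if k = m then a m
                    else if k - 1 < m then (restrict a {..<m}) (k - 1) else v (k - 1 - m))"
        by (auto simp: fun_eq_iff)
      with Q show ?L
        unfolding Q'_def by (intro bexI[of _ "restrict a {..<m}"]) auto
    qed
    ultimately show ?case by simp
  qed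
  have eq: "(\<lambda>k\<in>{..<n}. if k < n then a k else v (k - n)) = a" if "a \<in> cart_power n" for v a
    using PiE_arb[OF that] by (auto simp: fun_eq_iff)
  have "(\<exists>a\<in>cart_power n. P (\<lambda>k. if k + n < n then a (k + n) else v (k + n - n))
        (\<lambda>k\<in>{..<n}. if k < n then a k else v (k - n))) \<longleftrightarrow> (\<exists>a\<in>cart_power n. P v a)" for v
    by (intro bex_cong refl) (simp only: not_add_less2 if_False add_diff_cancel_right' eq[of _ v])
  then show ?thesis using *[OF assms, of n] by (simp only:)
qed

section \<open>Terms given by definable graphs, and their substitution\<close>

definition definable_term ::
    "('f, 'r, 'a) fo_structure \<Rightarrow> ((nat \<Rightarrow> 'a) \<Rightarrow> 'a) \<Rightarrow> bool" where
  "definable_term \<M> t \<longleftrightarrow> definable_pred \<M> (\<lambda>v. v 0 = t (\<lambda>k. v (Suc k)))"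

lemma definable_eq_var: "definable_pred \<M> (\<lambda>v. v i = v j)"
  by (rule definable_predI[where \<phi> = "Eq (Var (2 * i)) (Var (2 * j))"])
    (auto simp: interleave_def)

lemma definable_term_var: "definable_term \<M> (\<lambda>v. v k)"
  unfolding definable_term_def by (rule definable_eq_var)

lemma definable_term_const: "definable_term \<M> (\<lambda>v. c)"
  unfolding definable_term_def
  by (rule definable_predI[where \<phi> = "Eq (Var 0) (Var 1)" and e = "\<lambda>_. c"])
    (auto simp: interleave_def)

text \<open>\<open>P (s v)\<close> says that some point \<open>a\<close> has the coordinates
  \<open>s v k\<close> and satisfies \<open>P\<close>. Only finitely many coordinates can be
  quantified, hence the condition \<open>dep\<close> that \<open>P\<close> looks at the first
  \<open>n\<close> only.\<close>

lemma definable_pred_comp: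
  assumes P: "definable_pred \<M> P"
    and dep: "\<And>v w. (\<And>k. k < n \<Longrightarrow> v k = w k) \<Longrightarrow> P v \<Longrightarrow> P w"
    and s: "\<And>k. k < n \<Longrightarrow> definable_term \<M> (\<lambda>v. s v k)"
  shows "definable_pred \<M> (\<lambda>v. P (s v))"
proof -
  have "definable_pred \<M> (\<lambda>v. v k = s (\<lambda>j. v (j + n)) k)" if "k < n" for k
    using definable_pred_shift[OF s[OF that, unfolded definable_term_def], of "case_nat k (\<lambda>i. i + n)"]
    by simp
  then have 1: "definable_pred \<M> (\<lambda>v. (\<forall>k<n. v k = s (\<lambda>j. v (j + n)) k) \<and> P v)"
    by (intro definable_pred_conj definable_pred_all_less P)
  have "P (restrict v {..<n}) \<longleftrightarrow> P v" for v
    using dep[of v "restrict v {..<n}"] dep[of "restrict v {..<n}" v] by auto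
  moreover have "(\<forall>k<n. restrict v {..<n} k = w k) \<longleftrightarrow> (\<forall>k<n. v k = w k)" for v w :: "nat \<Rightarrow> 'c"
    by simp
  ultimately have 2: "definable_pred \<M> (\<lambda>v. \<exists>a\<in>cart_power n. (\<forall>k<n. a k = s v k) \<and> P a)"
    by (intro definable_pred_ex_cart) (simp only: 1)
  have 3: "(\<exists>a\<in>cart_power n. (\<forall>k<n. a k = s v k) \<and> P a) \<longleftrightarrow> P (s v)" for v
  proof
    assume "P (s v)"
    then have "P (restrict (s v) {..<n})" using dep[of "s v" "restrict (s v) {..<n}"] by auto
    then show "\<exists>a\<in>cart_power n. (\<forall>k<n. a k = s v k) \<and> P a"
      by (intro bexI[of _ "restrict (s v) {..<n}"] conjI) auto
  next
    assume "\<exists>a\<in>cart_power n. (\<forall>k<n. a k = s v k) \<and> P a"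
    then obtain a where "\<forall>k<n. a k = s v k" "P a" by blast
    then show "P (s v)" using dep[of a "s v"] by blast
  qed
  show ?thesis using 2 unfolding 3 .
qed

lemma definable_term_comp:
  assumes t: "definable_term \<M> t"
    and dep: "\<And>v w. (\<And>k. k < n \<Longrightarrow> v k = w k) \<Longrightarrow> t v = t w"
    and s: "\<And>k. k < n \<Longrightarrow> definable_term \<M> (\<lambda>v. s v k)"
  shows "definable_term \<M> (\<lambda>v. t (s v))"
proof -
  \<comment> \<open>Coordinate \<open>0\<close> carries the value in the graph of \<open>t\<close>
    and stays in place; the substitution acts on the shifted coordinates.\<close>
  define s' where "s' v k = (case k of 0 \<Rightarrow> v 0 | Suc i \<Rightarrow> s (\<lambda>k. v (Suc k)) i)" for v k
  have "definable_pred \<M> (\<lambda>v. (\<lambda>v. v 0 = t (\<lambda>k. v (Suc k))) (s' v))"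
  proof (rule definable_pred_comp[where n = "Suc n"])
    show "definable_term \<M> (\<lambda>v. s' v k)" if "k < Suc n" for k
    proof (cases k)
      case 0
      then show ?thesis by (simp add: s'_def definable_term_var)
    next
      case (Suc i)
      then have "definable_term \<M> (\<lambda>v. s v i)" using s that by auto
      from definable_pred_shift[OF this[unfolded definable_term_def], of "case_nat 0 (\<lambda>i. Suc (Suc i))"]
      show ?thesis by (simp add: definable_term_def s'_def Suc)
    qed
    show "w 0 = t (\<lambda>k. w (Suc k))"
      if "\<And>k. k < Suc n \<Longrightarrow> v k = w k" "v 0 = t (\<lambda>k. v (Suc k))" for v w
      using that(1)[of 0] that(2) dep[of "\<lambda>k. v (Suc k)" "\<lambda>k. w (Suc k)"] that(1) by simp
  qed (use t in \<open>simp add: definable_term_def\<close>)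
  then show ?thesis by (simp add: s'_def definable_term_def)
qed

lemma definable_pred_binary:
  assumes "definable_pred \<M> (\<lambda>v. R (v 0) (v 1))" "definable_term \<M> s" "definable_term \<M> t"
  shows "definable_pred \<M> (\<lambda>v. R (s v) (t v))"
proof -
  have "definable_term \<M> (\<lambda>v. if k = 0 then s v else t v)" for k :: nat
    using assms(2,3) by (cases "k = 0") simp_all
  from definable_pred_comp[where n = 2 and s = "\<lambda>v k. if k = 0 then s v else t v", OF assms(1) _ this]
  show ?thesis by simp
qed

lemma definable_term_unary:
  assumes "definable_term \<M> (\<lambda>v. f (v 0))" "definable_term \<M> s"
  shows "definable_term \<M> (\<lambda>v. f (s v))"
  using definable_term_comp[where n = 1 and s = "\<lambda>v k. s v", OF assms(1)] assms(2) by simp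

lemma definable_term_binary:
  assumes "definable_term \<M> (\<lambda>v. f (v 0) (v 1))" "definable_term \<M> s" "definable_term \<M> t"
  shows "definable_term \<M> (\<lambda>v. f (s v) (t v))"
proof -
  have "definable_term \<M> (\<lambda>v. if k = 0 then s v else t v)" for k :: nat
    using assms(2,3) by (cases "k = 0") simp_all
  from definable_term_comp[where n = 2 and s = "\<lambda>v k. if k = 0 then s v else t v", OF assms(1) _ this]
  show ?thesis by simp
qed

lemma definable_pred_eq:
  "definable_term \<M> s \<Longrightarrow> definable_term \<M> t \<Longrightarrow> definable_pred \<M> (\<lambda>v. s v = t v)"
  by (rule definable_pred_binary[where R = "(=)", OF definable_eq_var])

lemma definable_term_shift:
  assumes "definable_term \<M> t"
  shows "definable_term \<M> (\<lambda>v. t (\<lambda>k. v (\<sigma> k)))"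
  using definable_pred_shift[OF assms[unfolded definable_term_def], of "case_nat 0 (\<lambda>i. Suc (\<sigma> i))"]
  by (simp add: definable_term_def)

lemma definable_term_if:
  assumes "definable_pred \<M> P" "definable_term \<M> s" "definable_term \<M> t"
  shows "definable_term \<M> (\<lambda>v. if P v then s v else t v)"
proof -
  have "definable_pred \<M> (\<lambda>v. (P (\<lambda>k. v (Suc k)) \<longrightarrow> v 0 = s (\<lambda>k. v (Suc k))) \<and>
      (\<not> P (\<lambda>k. v (Suc k)) \<longrightarrow> v 0 = t (\<lambda>k. v (Suc k))))"
    by (intro definable_pred_conj definable_pred_imp definable_pred_Not definable_pred_shift[OF assms(1)]
        assms(2,3)[unfolded definable_term_def])
  then show ?thesis unfolding definable_term_def by (rule back_subst[of "definable_pred \<M>"]) auto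
qed

section \<open>Translation between definable sets and definable predicates\<close>

lemma definable_pred_sat:
  "wf_formula \<M> \<phi> \<Longrightarrow> definable_pred \<M> (\<lambda>v. sat \<M> v \<phi>)"
proof (induction \<phi>)
  case (Exists i \<phi>)
  \<comment> \<open>The bound variable \<open>i\<close> may be even, so the formula is not itself a
    witness; the quantifier is rebuilt with the bound value moved to coordinate
    \<open>0\<close>.\<close>
  have "definable_pred \<M> (\<lambda>v. \<exists>a. sat \<M> (\<lambda>k. if k = i then a else v k) \<phi>)"
  proof (rule definable_pred_ex)
    have "definable_pred \<M> (\<lambda>v. sat \<M> v \<phi>)" using Exists by simp
    from definable_pred_shift[OF this, of "\<lambda>k. if k = i then 0 else Suc k"]
    show "definable_pred \<M> (\<lambda>v. sat \<M> (\<lambda>k. if k = i then v 0 else v (Suc k)) \<phi>)"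
      by (simp only: if_distrib[of "\<lambda>k. _ k"])
  qed
  then show ?case by (simp only: sat.simps fun_upd_def)
next
  case (Eq s t)
  then show ?case
    by (intro definable_predI[where \<phi> = "rename_formula (\<lambda>k. 2 * k) (Eq s t)"])
      (auto simp: term_val_rename interleave_def)
next
  case (Rel r ts)
  have "map (term_val \<M> (interleave v e)) (map (rename_term (\<lambda>k. 2 * k)) ts) = map (term_val \<M> v) ts"
    for v e by (auto simp: term_val_rename interleave_def)
  with Rel show ?case
    by (intro definable_predI[where \<phi> = "rename_formula (\<lambda>k. 2 * k) (Rel r ts)"])
      (simp_all only: wf_rename_formula, simp_all only: rename_formula.simps sat.simps bound_vars.simps empty_iff)
next
  case (Neg \<phi>)
  then show ?case by (simp add: definable_pred_Not)
next
  case (Conj \<phi> \<psi>)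
  then show ?case by (simp add: definable_pred_conj)
qed

lemma definable_pred_restrict_mem:
  assumes "definable \<M> n A"
  shows "definable_pred \<M> (\<lambda>v. restrict v {..<n} \<in> A)"
proof -
  obtain \<phi> e where \<phi>: "wf_formula \<M> \<phi>"
      and A: "A = {x \<in> cart_power n. sat \<M> (override_on e x {..<n}) \<phi>}"
    using assms unfolding definable_def by blast
  have "definable_pred \<M> (\<lambda>v. sat \<M> (override_on e v {..<n}) \<phi>)"
    by (rule definable_pred_subst[OF definable_pred_sat[OF \<phi>]]) (auto simp: override_on_def)
  moreover have "override_on e (restrict v {..<n}) {..<n} = override_on e v {..<n}" for v
    by (auto simp: override_on_def)
  ultimately show ?thesis by (simp add: A)
qed

lemma definable_Collect:
  assumes "definable_pred \<M> P"
  shows "definable \<M> n {x \<in> cart_power n. P x}"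
proof -
  obtain \<phi> e where \<phi>: "wf_formula \<M> \<phi>" "\<And>b. b \<in> bound_vars \<phi> \<Longrightarrow> odd b"
      "\<And>v. P v \<longleftrightarrow> sat \<M> (interleave v e) \<phi>"
    using definable_predE[OF assms] by blast
  \<comment> \<open>A point of \<open>cart_power n\<close> is \<open>undefined\<close> from
    coordinate \<open>n\<close> on. The variables standing for those coordinates become parameters
    with exactly that value.\<close>
  define \<rho> where "\<rho> k = (if even k \<and> k < 2 * n then k div 2 else n + k)" for k
  define e' where "e' k = interleave (\<lambda>_. undefined) e (k - n)" for k
  have eq: "(\<lambda>k. override_on e' x {..<n} (\<rho> k)) = interleave x e" if "x \<in> cart_power n" for x
  proof (rule eq_interleaveI)
    show "override_on e' x {..<n} (\<rho> (2 * k)) = x k" for k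
      using PiE_arb[OF that, of k] by (simp add: override_on_def \<rho>_def e'_def interleave_def)
  qed (simp add: override_on_def \<rho>_def e'_def interleave_def)
  have "\<rho> k \<noteq> \<rho> b" if "k \<noteq> b" for k b
    using that by (auto simp: \<rho>_def elim!: evenE)
  then have "sat \<M> e'' (rename_formula \<rho> \<phi>) = sat \<M> (\<lambda>k. e'' (\<rho> k)) \<phi>" for e''
    by (intro sat_rename) simp
  then have "{x \<in> cart_power n. P x} =
      {x \<in> cart_power n. sat \<M> (override_on e' x {..<n}) (rename_formula \<rho> \<phi>)}"
    using eq \<phi>(3) by auto
  then show ?thesis
    unfolding definable_def
    by (intro exI[of _ "rename_formula \<rho> \<phi>"] exI[of _ e'] conjI) (simp_all only: wf_rename_formula \<phi>(1))
qed

named_theorems definable_intros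

lemmas [definable_intros] =
  definable_pred_const definable_pred_Not definable_pred_conj definable_pred_disj
  definable_pred_imp definable_pred_ex definable_pred_all
  definable_pred_all_less definable_pred_eq
  definable_term_var definable_term_const definable_term_if

lemma definable_pred_unary:
  assumes "definable_pred \<M> (\<lambda>v. P (v 0))" "definable_term \<M> t"
  shows "definable_pred \<M> (\<lambda>v. P (t v))"
  using definable_pred_comp[where n = 1 and s = "\<lambda>v k. t v", OF assms(1)] assms(2) by simp

section \<open>O-minimal ordered groups\<close>

definition is_glb :: "'a::order set \<Rightarrow> 'a \<Rightarrow> bool" where
  "is_glb S s \<longleftrightarrow> (\<forall>t. t \<in> S \<longrightarrow> s \<le> t) \<and> (\<forall>u. (\<forall>t. t \<in> S \<longrightarrow> u \<le> t) \<longrightarrow> u \<le> s)"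

definition is_lub :: "'a::order set \<Rightarrow> 'a \<Rightarrow> bool" where
  "is_lub S s \<longleftrightarrow> (\<forall>t. t \<in> S \<longrightarrow> t \<le> s) \<and> (\<forall>u. (\<forall>t. t \<in> S \<longrightarrow> t \<le> u) \<longrightarrow> s \<le> u)"

definition glb :: "'a::{order, zero} set \<Rightarrow> 'a" where
  "glb S = (if \<exists>s. is_glb S s then THE s. is_glb S s else 0)"

definition lub :: "'a::{order, zero} set \<Rightarrow> 'a" where
  "lub S = (if \<exists>s. is_lub S s then THE s. is_lub S s else 0)"

lemma glb_eq: "is_glb S s \<Longrightarrow> glb S = s"
proof -
  assume s: "is_glb S s"
  then have "s' = s" if "is_glb S s'" for s'
    using that unfolding is_glb_def by (blast intro: order.antisym)
  with s have "(THE s. is_glb S s) = s" by (rule the_equality)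
  then show ?thesis using s by (auto simp: glb_def)
qed

lemma lub_eq: "is_lub S s \<Longrightarrow> lub S = s"
proof -
  assume s: "is_lub S s"
  then have "s' = s" if "is_lub S s'" for s'
    using that unfolding is_lub_def by (blast intro: order.antisym)
  with s have "(THE s. is_lub S s) = s" by (rule the_equality)
  then show ?thesis using s by (auto simp: lub_def)
qed

text \<open>This description of the graph, default value included, is first-order in membership in
  \<open>S\<close>. It is what makes the infimum of a definable family a definable term.\<close>

lemma eq_glb_iff: "x = glb S \<longleftrightarrow> is_glb S x \<or> (\<not> (\<exists>s. is_glb S s) \<and> x = 0)"
proof (cases "\<exists>s. is_glb S s")
  case True
  then show ?thesis using glb_eq by blast
next
  case False
  then show ?thesis by (simp add: glb_def)
qed

lemma eq_lub_iff: "x = lub S \<longleftrightarrow> is_lub S x \<or> (\<not> (\<exists>s. is_lub S s) \<and> x = 0)"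
proof (cases "\<exists>s. is_lub S s")
  case True
  then show ?thesis using lub_eq by blast
next
  case False
  then show ?thesis by (simp add: lub_def)
qed

lemma is_glb_less_iff: "is_glb S s \<Longrightarrow> s < (u::'a::linorder) \<longleftrightarrow> (\<exists>t\<in>S. t < u)"
  unfolding is_glb_def not_le[symmetric] by (blast intro: order_trans)

lemma is_lub_less_iff: "is_lub S s \<Longrightarrow> (u::'a::linorder) < s \<longleftrightarrow> (\<exists>t\<in>S. u < t)"
  unfolding is_lub_def not_le[symmetric] by (blast intro: order_trans)

lemma continuous_map_into_order_topologyI:
  fixes F :: "'b \<Rightarrow> 'a::linorder_topology"
  assumes "\<And>t. openin X {x \<in> topspace X. F x < t}" "\<And>t. openin X {x \<in> topspace X. t < F x}"
  shows "continuous_map X euclidean F"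
proof -
  have "openin X {x \<in> topspace X. F x \<in> U}" if "open U" for U
    using that unfolding open_generated_order
  proof (induction U rule: generate_topology.induct)
    case (Int U V)
    then have "openin X ({x \<in> topspace X. F x \<in> U} \<inter> {x \<in> topspace X. F x \<in> V})" by blast
    also have "{x \<in> topspace X. F x \<in> U} \<inter> {x \<in> topspace X. F x \<in> V} = {x \<in> topspace X. F x \<in> U \<inter> V}"
      by auto
    finally show ?case .
  next
    case (UN K)
    then have "openin X (\<Union>U\<in>K. {x \<in> topspace X. F x \<in> U})" by blast
    also have "(\<Union>U\<in>K. {x \<in> topspace X. F x \<in> U}) = {x \<in> topspace X. F x \<in> \<Union>K}" by auto
    finally show ?case .
  qed (use assms in auto)
  then show ?thesis by (simp add: continuous_map)
qed

locale o_minimal_group =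
  fixes \<M> :: "('f, 'r, 'a::{linordered_group_add, dense_linorder, no_bot, no_top, linorder_topology}) fo_structure"
  assumes expands: "expands_ordered_group \<M>"
    and omin: "o_minimal \<M>"
begin

abbreviation "dpred \<equiv> definable_pred \<M>"
abbreviation "dterm \<equiv> definable_term \<M>"

section \<open>Definability of the order, the group operations, infima and suprema\<close>

lemma dpred_less [definable_intros]:
  assumes "dterm s" "dterm t"
  shows "dpred (\<lambda>v. s v < t v)"
proof -
  obtain r where r: "rel_arity \<M> r = 2" "\<And>a b. rel_interp \<M> r [a, b] \<longleftrightarrow> a < b"
    using expands unfolding expands_ordered_group_def by blast
  have "dpred (\<lambda>v. sat \<M> v (Rel r [Var 0, Var 1]))"
    by (rule definable_pred_sat) (simp add: r)
  then have "dpred (\<lambda>v. v 0 < v 1)" by (simp add: r)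
  then show ?thesis using assms by (rule definable_pred_binary)
qed

lemma dpred_le [definable_intros]:
  "dterm s \<Longrightarrow> dterm t \<Longrightarrow> dpred (\<lambda>v. s v \<le> t v)"
  unfolding le_less by (intro definable_intros)

lemma dterm_add [definable_intros]:
  assumes "dterm s" "dterm t"
  shows "dterm (\<lambda>v. s v + t v)"
proof -
  obtain f where f: "fun_arity \<M> f = 2" "\<And>a b. fun_interp \<M> f [a, b] = a + b"
    using expands unfolding expands_ordered_group_def by blast
  have "dpred (\<lambda>v. sat \<M> v (Eq (Var 0) (Fun f [Var 1, Var 2])))"
    by (rule definable_pred_sat) (simp add: f)
  then have "dterm (\<lambda>v. v 0 + v 1)" by (simp add: f definable_term_def numeral_2_eq_2)
  then show ?thesis using assms by (rule definable_term_binary)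
qed

lemma dterm_uminus [definable_intros]:
  assumes "dterm t"
  shows "dterm (\<lambda>v. - t v)"
proof -
  have "dpred (\<lambda>v. v 0 + v (Suc 0) = 0)" by (intro definable_intros)
  then have "dterm (\<lambda>v. - v 0)" by (simp add: definable_term_def eq_neg_iff_add_eq_0)
  then show ?thesis using assms by (rule definable_term_unary)
qed

lemma dterm_diff [definable_intros]:
  "dterm s \<Longrightarrow> dterm t \<Longrightarrow> dterm (\<lambda>v. s v - t v)"
  using dterm_add[OF _ dterm_uminus, of s t] by simp

lemma dterm_max [definable_intros]:
  "dterm s \<Longrightarrow> dterm t \<Longrightarrow> dterm (\<lambda>v. max (s v) (t v))"
  unfolding max_def by (intro definable_intros)

lemma dterm_min [definable_intros]:
  "dterm s \<Longrightarrow> dterm t \<Longrightarrow> dterm (\<lambda>v. min (s v) (t v))"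
  unfolding min_def by (intro definable_intros)

lemma dterm_glb [definable_intros]:
  assumes "dpred (\<lambda>v. S (\<lambda>k. v (Suc k)) (v 0))"
  shows "dterm (\<lambda>v. glb {t. S v t})"
proof -
  \<comment> \<open>In the graph of \<open>glb\<close> the family occurs under different numbers of
    quantifiers, so its definability is required under arbitrary renamings of the
    coordinates.\<close>
  have "dpred (\<lambda>v. S (\<lambda>k. v (\<sigma> (Suc k))) (v (\<sigma> 0)))" for \<sigma> :: "nat \<Rightarrow> nat"
    by (rule definable_pred_shift[OF assms])
  note S = this[of "case_nat i \<tau>" for i \<tau>, simplified]
  show ?thesis
    unfolding definable_term_def eq_glb_iff is_glb_def mem_Collect_eq
    by (intro definable_intros S)
qed

lemma dterm_lub [definable_intros]:
  assumes "dpred (\<lambda>v. S (\<lambda>k. v (Suc k)) (v 0))"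
  shows "dterm (\<lambda>v. lub {t. S v t})"
proof -
  have "dpred (\<lambda>v. S (\<lambda>k. v (\<sigma> (Suc k))) (v (\<sigma> 0)))" for \<sigma> :: "nat \<Rightarrow> nat"
    by (rule definable_pred_shift[OF assms])
  note S = this[of "case_nat i \<tau>" for i \<tau>, simplified]
  show ?thesis
    unfolding definable_term_def eq_lub_iff is_lub_def mem_Collect_eq
    by (intro definable_intros S)
qed

section \<open>Germs of definable sets and definable completeness\<close>

lemma finite_union_intervals:
  assumes "dpred (\<lambda>v. P (v 0))"
  obtains \<I> where "finite \<I>" "\<And>I. I \<in> \<I> \<Longrightarrow> open_interval I \<or> (\<exists>a. I = {a})" "Collect P = \<Union>\<I>"
proof -
  have "{x \<in> cart_power 1. P (x 0)} = line_set (Collect P)"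
    by (simp add: line_set_def)
  then have "definable \<M> 1 (line_set (Collect P))"
    using definable_Collect[OF assms, of 1] by simp
  then obtain \<I> where "finite \<I>" "\<forall>I\<in>\<I>. open_interval I \<or> (\<exists>a. I = {a})" "Collect P = \<Union>\<I>"
    using omin unfolding o_minimal_def by metis
  then show ?thesis using that by metis
qed

text \<open>A filter that decides every open ray decides all finite Boolean combinations of rays,
  and by o-minimality these include all definable sets. The filters used are those at infinity and
  to the right of a point.\<close>

lemma definable_dichotomy:
  assumes P: "dpred (\<lambda>v. P (v 0))"
    and F: "\<And>a. eventually (\<lambda>x. x < a) F \<or> eventually (\<lambda>x. \<not> x < a) F"
      "\<And>a. eventually (\<lambda>x. x > a) F \<or> eventually (\<lambda>x. \<not> x > a) F"
  shows "eventually P F \<or> eventually (\<lambda>x. \<not> P x) F"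
proof -
  define dec where "dec I \<longleftrightarrow> eventually (\<lambda>x. x \<in> I) F \<or> eventually (\<lambda>x. x \<notin> I) F" for I
  have Int: "dec (I \<inter> J)" if "dec I" "dec J" for I J
    using that[unfolded dec_def]
  proof (elim disjE)
    assume "eventually (\<lambda>x. x \<in> I) F" "eventually (\<lambda>x. x \<in> J) F"
    then have "eventually (\<lambda>x. x \<in> I \<inter> J) F" by eventually_elim simp
    then show ?thesis by (simp add: dec_def)
  qed (unfold dec_def, (rule disjI2, erule (1) eventually_elim2, simp)+)
  have Compl: "dec (- I)" if "dec I" for I
    using that unfolding dec_def by auto
  have less: "dec {..<a}" and greater: "dec {a<..}" for a
    using F unfolding dec_def by auto
  have ivl: "dec I" if "open_interval I \<or> (\<exists>a. I = {a})" for I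
  proof -
    have "dec {a<..<b}" for a b
      unfolding greaterThanLessThan_def by (intro Int less greater)
    moreover have "dec {a}" for a
    proof -
      have "{a} = - {..<a} \<inter> - {a<..}" by auto
      then show ?thesis using Int[OF Compl[OF less] Compl[OF greater], of a a] by simp
    qed
    moreover have "dec UNIV" by (simp add: dec_def)
    ultimately show ?thesis
      using that less greater unfolding open_interval_def by (elim disjE exE conjE) simp_all
  qed
  obtain \<I> where \<I>: "finite \<I>" "\<And>I. I \<in> \<I> \<Longrightarrow> open_interval I \<or> (\<exists>a. I = {a})" "Collect P = \<Union>\<I>"
    using finite_union_intervals[OF P] by blast
  have "dec (\<Union>\<J>)" if "finite \<J>" "\<And>I. I \<in> \<J> \<Longrightarrow> dec I" for \<J>
    using that
  proof (induction \<J> rule: finite_induct)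
    case empty
    then show ?case by (simp add: dec_def)
  next
    case (insert I \<J>)
    have "\<Union>(insert I \<J>) = - (- I \<inter> - \<Union>\<J>)" by auto
    moreover have "dec I" "dec (\<Union>\<J>)" using insert by auto
    ultimately show ?case using Compl[OF Int[OF Compl Compl]] by simp
  qed
  from this[of \<I>] have "dec (Collect P)" using \<I> ivl by simp
  then show ?thesis by (simp add: dec_def)
qed

lemma eventually_at_top_dichotomy:
  assumes "dpred (\<lambda>v. P (v 0))"
  shows "(\<exists>c. \<forall>x>c. P x) \<or> (\<exists>c. \<forall>x>c. \<not> P x)"
proof -
  have "eventually (\<lambda>x. x < a) at_top \<or> eventually (\<lambda>x. \<not> x < a) at_top" for a :: 'a
    using eventually_ge_at_top[of a] by (simp add: not_less)
  moreover have "eventually (\<lambda>x. x > a) at_top \<or> eventually (\<lambda>x. \<not> x > a) at_top" for a :: 'a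
    using eventually_gt_at_top[of a] by blast
  ultimately show ?thesis
    using definable_dichotomy[OF assms, of at_top] by (simp add: eventually_at_top_dense)
qed

lemma eventually_at_right_dichotomy:
  assumes "dpred (\<lambda>v. P (v 0))"
  shows "(\<exists>c>s. \<forall>x. s < x \<and> x < c \<longrightarrow> P x) \<or> (\<exists>c>s. \<forall>x. s < x \<and> x < c \<longrightarrow> \<not> P x)"
proof -
  obtain b where b: "s < b" using gt_ex by blast
  note ev = eventually_at_right[OF b]
  have "eventually (\<lambda>x. x < a) (at_right s) \<or> eventually (\<lambda>x. \<not> x < a) (at_right s)" for a
    unfolding ev using b by (cases "s < a") (auto intro: exI[of _ b])
  moreover have "eventually (\<lambda>x. x > a) (at_right s) \<or> eventually (\<lambda>x. \<not> x > a) (at_right s)" for a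
    unfolding ev using b by (cases "s < a") (auto intro: exI[of _ b])
  ultimately show ?thesis
    using definable_dichotomy[OF assms, of "at_right s"] unfolding ev by auto
qed

text \<open>A nonempty interval or point bounded below has its left endpoint as infimum, and the
  infimum of a finite union is the least of the infima.\<close>

lemma is_glb_glb:
  assumes P: "dpred (\<lambda>v. P (v 0))" and "P a" and "\<And>x. P x \<Longrightarrow> l \<le> x"
  shows "is_glb {x. P x} (glb {x. P x})"
proof -
  obtain \<I> where \<I>: "finite \<I>" "\<And>I. I \<in> \<I> \<Longrightarrow> open_interval I \<or> (\<exists>a. I = {a})" "Collect P = \<Union>\<I>"
    using finite_union_intervals[OF P] by blast
  have ivl: "\<exists>s. is_glb I s" if "open_interval I \<or> (\<exists>a. I = {a})" "\<forall>x\<in>I. l \<le> x" for I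
  proof -
    have "is_glb {a<..<b} a" if "a < b" for a b :: 'a
      using dense_ge_bounded[OF that] by (simp add: is_glb_def less_imp_le)
    moreover have "is_glb {a<..} a" for a :: 'a
      using dense_ge[of a] by (simp add: is_glb_def less_imp_le)
    moreover have "\<not> (\<forall>x\<in>{..<b}. l \<le> x)" for b
      using lt_ex[of "min l b"] by (simp add: not_le) blast
    moreover have "\<exists>x. \<not> l \<le> x"
      using lt_ex[of l] by (simp add: not_le)
    moreover have "is_glb {a} a" for a :: 'a by (simp add: is_glb_def)
    ultimately show ?thesis
      using that unfolding open_interval_def
      by (elim disjE exE conjE) (simp_all, blast+)
  qed
  have "\<J> = {} \<or> (\<exists>s. is_glb (\<Union>\<J>) s)"
    if "finite \<J>" "\<J> \<subseteq> \<I>" for \<J>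
    using that
  proof (induction \<J> rule: finite_induct)
    case (insert I \<J>)
    have "\<forall>x\<in>I. l \<le> x" using insert.prems \<I>(3) assms(3) by blast
    moreover have "open_interval I \<or> (\<exists>a. I = {a})" using \<I>(2) insert.prems by simp
    ultimately obtain s where s: "is_glb I s" using ivl by metis
    show ?case
    proof (cases "\<J> = {}")
      case True
      then show ?thesis using s by auto
    next
      case False
      then obtain s' where s': "is_glb (\<Union>\<J>) s'" using insert by blast
      have "is_glb (I \<union> \<Union>\<J>) (min s s')"
        using s s' unfolding is_glb_def by (auto simp: min_le_iff_disj)
      then show ?thesis by auto
    qed
  qed simp
  from this[OF \<I>(1) order_refl] have "\<exists>s. is_glb (Collect P) s"
    using \<I>(3) \<open>P a\<close> by auto
  then show ?thesis using glb_eq by metis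
qed

text \<open>The supremum is the infimum of the upper bounds, which again form a definable
  set.\<close>

lemma is_lub_lub:
  assumes P: "dpred (\<lambda>v. P (v 0))" and "P a" and "\<And>x. P x \<Longrightarrow> x \<le> u"
  shows "is_lub {x. P x} (lub {x. P x})"
proof -
  have "dpred (\<lambda>v. \<forall>x. P x \<longrightarrow> x \<le> v 0)"
    by (intro definable_intros definable_pred_unary[OF P])
  from is_glb_glb[OF this, of u a] assms(2,3)
  have "is_glb {y. \<forall>x. P x \<longrightarrow> x \<le> y} (glb {y. \<forall>x. P x \<longrightarrow> x \<le> y})" by blast
  then have "is_lub {x. P x} (glb {y. \<forall>x. P x \<longrightarrow> x \<le> y})"
    unfolding is_glb_def is_lub_def by blast
  then show ?thesis using lub_eq by metis
qed


text \<open>A nontrivial definable subgroup is cofinal, hence contains a final segment, hence is the whole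
  group. This is applied to centralizers.\<close>

lemma definable_subgroup_trivial:
  assumes H: "dpred (\<lambda>v. H (v 0))"
    and add: "\<And>x y. H x \<Longrightarrow> H y \<Longrightarrow> H (x + y)" and minus: "\<And>x. H x \<Longrightarrow> H (- x)"
    and a: "H a" "a \<noteq> 0"
  shows "H x"
proof -
  obtain c where c: "H c" "0 < c"
  proof (cases "0 < a")
    case False
    then have "a < 0" using a(2) by simp
    then have "- a + a < - a + 0" by (rule add_left_strict_mono_group)
    then show ?thesis using that[of "- a"] minus a(1) by simp
  qed (use a that in blast)
  have cofinal: "\<exists>h. H h \<and> t < h" for t
  proof (rule ccontr)
    assume "\<nexists>h. H h \<and> t < h"
    then have "\<And>x. H x \<Longrightarrow> x \<le> t" by force
    from is_lub_lub[OF H c(1) this] obtain s where s: "is_lub {x. H x} s" by blast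
    have "s + - c < s + 0"
      using add_left_strict_mono_group[OF add_left_strict_mono_group[OF c(2), of "- c"], of s] by simp
    then obtain h where h: "H h" "s + - c < h"
      using is_lub_less_iff[OF s] by auto
    from add_right_strict_mono_group[OF h(2), of c] have "s < h + c"
      by (simp add: add.assoc)
    moreover have "h + c \<le> s" using s add[OF h(1) c(1)] by (simp add: is_lub_def)
    ultimately show False by simp
  qed
  then obtain k where k: "\<And>y. k < y \<Longrightarrow> H y"
    using eventually_at_top_dichotomy[OF H] by blast
  \<comment> \<open>This puts \<open>x + h\<close> into the final segment contained in
    \<open>H\<close>; then \<open>x\<close> is a difference of two members of
    \<open>H\<close>.\<close>
  obtain h where h: "H h" "- x + k < h" using cofinal by blast
  from add_left_strict_mono_group[OF h(2), of x] have "k < x + h" by (simp add: add.assoc[symmetric])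
  then have "H (x + h + - h)" using k h add minus by blast
  then show ?thesis by (simp add: add.assoc)
qed

lemma add_commute: "x + y = y + (x :: 'a)"
proof (cases "y = 0")
  case False
  have "dpred (\<lambda>v. v 0 + y = y + v 0)" by (intro definable_intros)
  then show ?thesis
  proof (rule definable_subgroup_trivial[where H = "\<lambda>x. x + y = y + x", OF _ _ _ refl False])
    show "a + b + y = y + (a + b)" if "a + y = y + a" "b + y = y + b" for a b
      using that by (metis add.assoc)
    show "- a + y = y + - a" if "a + y = y + a" for a
    proof -
      have "(- a + y) + a = y" by (simp only: add.assoc that[symmetric] minus_add_cancel)
      then have "(- a + y) + a + - a = y + - a" by simp
      then show ?thesis by (simp only: add.assoc right_minus add_0_right)
    qed
  qed
qed simp

text \<open>Commutativity is a consequence of the o-minimality of \<open>\<M>\<close> and not a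
  property of the type class, so the theory of ordered abelian groups enters by
  interpretation.\<close>

sublocale ab: linordered_ab_group_add
  where plus = "(+)" and zero = "0 :: 'a" and minus = "(-)" and uminus = uminus
    and less_eq = "(\<le>)" and less = "(<)"
proof
  show "a + b = b + a" for a b :: 'a by (rule add_commute)
  show "c + a \<le> c + b" if "a \<le> b" for a b c :: 'a
    using that add_left_strict_mono_group[of a b c] by (auto simp: le_less)
qed auto

text \<open>This takes the place of division by two: of the two positive parts in
  \<open>e = a + (e - a)\<close>, the smaller one has a double of at most \<open>e\<close>.\<close>

lemma half_pos:
  assumes "0 < (e::'a)"
  obtains d where "0 < d" "d + d \<le> e"
proof -
  obtain a where a: "0 < a" "a < e" using dense[OF assms] by blast
  have "min a (e - a) + min a (e - a) \<le> a + (e - a)" by (intro ab.add_mono) auto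
  also have "\<dots> = e" by (simp only: add_commute[of a] diff_add_cancel)
  finally show ?thesis using a that[of "min a (e - a)"] by (simp add: ab.less_diff_eq)
qed

lemma exists_pos: obtains u :: 'a where "0 < u"
  using gt_ex by blast

end

context o_minimal_group
begin

section \<open>Poles\<close>

lemma is_lub_upper: "is_lub S s \<Longrightarrow> t \<in> S \<Longrightarrow> t \<le> s"
  by (simp add: is_lub_def)

lemma is_lub_least: "is_lub S s \<Longrightarrow> (\<And>t. t \<in> S \<Longrightarrow> t \<le> u) \<Longrightarrow> s \<le> u"
  by (simp add: is_lub_def)

definition pole :: "('a \<Rightarrow> 'a) \<Rightarrow> 'a \<Rightarrow> bool" where
  "pole \<tau> e \<longleftrightarrow> dterm (\<lambda>v. \<tau> (v 0)) \<and> 0 < e \<and>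
     (\<forall>x y. 0 < x \<longrightarrow> x < y \<longrightarrow> y < e \<longrightarrow> \<tau> y < \<tau> x) \<and> \<tau> ` {0<..<e} = {0<..}"

text \<open>Since \<open>w\<close> is positive and becomes arbitrarily small, the dichotomy at
  \<open>0\<close> shows that its values fill some \<open>(0, \<epsilon>)\<close>. The suprema
  \<open>z v\<close> of its fibres are a strictly decreasing right inverse substitute, even if
  \<open>w\<close> is constant on intervals or fails to attain these suprema.\<close>

lemma ex_pole_of_decreasing:
  assumes w: "dterm (\<lambda>v. w (v 0))"
    and pos: "\<And>t. 0 < w t" and mono: "\<And>t t'. t \<le> t' \<Longrightarrow> w t' \<le> w t"
    and small: "\<And>\<epsilon>. 0 < \<epsilon> \<Longrightarrow> \<exists>t. w t < \<epsilon>"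
  shows "\<exists>\<tau> e. pole \<tau> e"
proof -
  note [definable_intros] = definable_term_unary[OF w]
  have "dpred (\<lambda>v. \<exists>t. w t = v 0)" by (intro definable_intros)
  from eventually_at_right_dichotomy[OF this, of 0]
  obtain \<epsilon> where "0 < \<epsilon>"
    and or: "(\<forall>v. 0 < v \<and> v < \<epsilon> \<longrightarrow> (\<exists>t. w t = v)) \<or> (\<forall>v. 0 < v \<and> v < \<epsilon> \<longrightarrow> \<not> (\<exists>t. w t = v))"
    by auto
  obtain t0 where "w t0 < \<epsilon>" using small[OF \<open>0 < \<epsilon>\<close>] by blast
  then have img: "\<exists>t. w t = v" if "0 < v" "v < \<epsilon>" for v
    using or that pos[of t0] by auto
  define z where "z v = lub {t. w t = v}" for v
  have z: "dterm (\<lambda>v. z (v 0))" unfolding z_def by (intro definable_intros)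
  note [definable_intros] = definable_term_unary[OF z]
  have less: "t < t'" if "w t' < w t" for t t'
    using mono[of t' t] that by (meson leD leI)
  have lub: "is_lub {t. w t = v} (z v)" if v: "0 < v" "v < \<epsilon>" for v
  proof -
    obtain a where a: "w a = v" using img[OF v] by blast
    obtain t1 where "w t1 < v" using small[OF v(1)] by blast
    then have "t \<le> t1" if "w t = v" for t using less[of t1 t] that by (simp add: less_imp_le)
    moreover have "dpred (\<lambda>u. w (u 0) = v)" by (intro definable_intros)
    ultimately show ?thesis unfolding z_def using is_lub_lub[of "\<lambda>t. w t = v" a t1] a by simp
  qed
  have decr: "z v' < z v" if v: "0 < v" "v < v'" "v' < \<epsilon>" for v v'
  proof -
    \<comment> \<open>A fibre over an intermediate value separates the other two: everything over
      \<open>v'\<close> lies at or below \<open>t''\<close>, and \<open>t'' < t\<close> with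
      \<open>t\<close> over \<open>v\<close>.\<close>
    obtain v'' where v'': "v < v''" "v'' < v'" using dense \<open>v < v'\<close> by blast
    obtain t'' where t'': "w t'' = v''" using img[of v''] v'' v by force
    obtain t where t: "w t = v" using img[of v] v by force
    have "t \<le> t''" if "w t = v'" for t
      using less[of t'' t] that t'' v'' by (simp add: less_imp_le)
    then have "z v' \<le> t''"
      using v by (intro is_lub_least[OF lub]) auto
    also have "t'' < t" using less t t'' v'' by simp
    also have "t \<le> z v" using v t by (intro is_lub_upper[OF lub]) auto
    finally show ?thesis .
  qed
  have unb: "\<exists>v. 0 < v \<and> v < \<epsilon> \<and> t < z v" for t
  proof -
    have "0 < min (w t) \<epsilon>" using pos \<open>0 < \<epsilon>\<close> by simp
    then obtain v where v: "0 < v" "v < min (w t) \<epsilon>" using dense by blast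
    obtain tv where tv: "w tv = v" using img v by force
    have "t < tv" using less[of tv t] tv v by simp
    also have "tv \<le> z v" using v tv by (intro is_lub_upper[OF lub]) auto
    finally show ?thesis using v by auto
  qed
  \<comment> \<open>The range of \<open>z\<close> is definable and unbounded above, so the dichotomy
    at infinity makes it contain a final segment.\<close>
  have "dpred (\<lambda>u. \<exists>v. 0 < v \<and> v < \<epsilon> \<and> z v = u 0)" by (intro definable_intros)
  from eventually_at_top_dichotomy[OF this]
  obtain c where "(\<forall>t>c. \<exists>v. 0 < v \<and> v < \<epsilon> \<and> z v = t) \<or> (\<forall>t>c. \<not> (\<exists>v. 0 < v \<and> v < \<epsilon> \<and> z v = t))"
    by blast
  then have zimg: "\<exists>v. 0 < v \<and> v < \<epsilon> \<and> z v = t" if "c < t" for t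
    using unb[of c] that by blast
  \<comment> \<open>All values above \<open>z e\<close> are attained, because \<open>z e\<close>
    exceeds \<open>c\<close>. Subtracting \<open>z e\<close> makes the range on
    \<open>(0, e)\<close> start at \<open>0\<close>.\<close>
  obtain e where e: "0 < e" "e < \<epsilon>" "c < z e" using unb[of c] by blast
  define \<tau> where "\<tau> v = z v - z e" for v
  have "(\<lambda>v. \<tau> v) ` {0<..<e} = {0<..}"
  proof (intro equalityI subsetI)
    fix r assume "r \<in> \<tau> ` {0<..<e}"
    then obtain v where "0 < v" "v < e" "r = \<tau> v" by auto
    then show "r \<in> {0<..}" using decr[of v e] e(2) by (simp add: \<tau>_def ab.less_diff_eq)
  next
    fix r assume "r \<in> {0::'a<..}"
    then have r: "z e < r + z e" by (simp add: ab.less_add_same_cancel2)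
    then obtain v where v: "0 < v" "v < \<epsilon>" "z v = r + z e"
      using zimg[of "r + z e"] e(3) by (meson order.strict_trans)
    have "v < e" using decr[of e v] v r e by (metis less_asym linorder_neqE less_irrefl)
    moreover have "r = \<tau> v" using v by (simp add: \<tau>_def)
    ultimately show "r \<in> \<tau> ` {0<..<e}" using v by simp
  qed
  moreover have "dterm (\<lambda>v. \<tau> (v 0))" unfolding \<tau>_def by (intro definable_intros)
  moreover have "\<tau> y < \<tau> x" if "0 < x" "x < y" "y < e" for x y
    using decr[of x y] that e(2) by (simp add: \<tau>_def ab.diff_strict_right_mono)
  ultimately show ?thesis
    using e(1) unfolding pole_def by (intro exI[of _ \<tau>] exI[of _ e] conjI) auto
qed

text \<open>Large values arbitrarily near \<open>0\<close> are, by the dichotomy, large values on a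
  whole interval \<open>(0, e)\<close>. The supremal length \<open>w t\<close> of such an interval
  for the threshold \<open>t\<close> is then positive and decreasing.\<close>

lemma ex_pole_of_unbounded_at_zero:
  assumes S: "dpred (\<lambda>v. S (v 0))" and g: "dterm (\<lambda>v. g (v 0))"
    and unb: "\<And>e t. 0 < e \<Longrightarrow> \<exists>y. 0 < y \<and> y < e \<and> S y \<and> t < g y"
  shows "\<exists>\<tau> e. pole \<tau> e"
proof -
  note [definable_intros] = definable_pred_unary[OF S] definable_term_unary[OF g]
  obtain u :: 'a where u: "0 < u" by (rule exists_pos)
  \<comment> \<open>The cap \<open>u\<close> bounds the admissible lengths, so that their supremum
    exists.\<close>
  define E where "E t e \<longleftrightarrow> e \<le> u \<and> (\<forall>y. 0 < y \<longrightarrow> y < e \<longrightarrow> S y \<and> t < g y)" for t e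
  define w where "w t = lub {e. E t e}" for t
  have E: "\<exists>e>0. E t e" for t
  proof -
    have "dpred (\<lambda>v. S (v 0) \<and> t < g (v 0))" by (intro definable_intros)
    from eventually_at_right_dichotomy[OF this, of 0]
    obtain c where "0 < c"
      and or: "(\<forall>x. 0 < x \<and> x < c \<longrightarrow> S x \<and> t < g x) \<or> (\<forall>x. 0 < x \<and> x < c \<longrightarrow> \<not> (S x \<and> t < g x))"
      by auto
    then have "\<forall>x. 0 < x \<and> x < c \<longrightarrow> S x \<and> t < g x" using unb[OF \<open>0 < c\<close>, of t] by blast
    then show ?thesis using u \<open>0 < c\<close> unfolding E_def by (intro exI[of _ "min c u"]) auto
  qed
  have dE: "dpred (\<lambda>v. E t (v 0))" for t unfolding E_def by (intro definable_intros)
  have lub: "is_lub {e. E t e} (w t)" for t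
    unfolding w_def
  proof -
    obtain e where "E t e" using E by blast
    moreover have "e \<le> u" if "E t e" for e using that by (simp add: E_def)
    ultimately show "is_lub {e. E t e} (lub {e. E t e})" by (rule is_lub_lub[OF dE])
  qed
  show ?thesis
  proof (rule ex_pole_of_decreasing)
    show "dterm (\<lambda>v. w (v 0))" unfolding w_def E_def by (intro definable_intros)
    show "0 < w t" for t
      using E[of t] is_lub_upper[OF lub[of t]] by (auto intro: less_le_trans)
    show "w t' \<le> w t" if "t \<le> t'" for t t'
    proof (rule is_lub_least[OF lub])
      fix e assume "e \<in> {e. E t' e}"
      then have "E t e" using that unfolding E_def by (auto intro: le_less_trans)
      then show "e \<le> w t" using is_lub_upper[OF lub] by simp
    qed
    show "\<exists>t. w t < \<epsilon>" if \<epsilon>: "0 < \<epsilon>" for \<epsilon>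
    proof -
      \<comment> \<open>The point \<open>y\<close> itself violates the strict inequality for the
        threshold \<open>g y\<close>, so no admissible interval for that threshold reaches beyond
        \<open>y\<close>.\<close>
      obtain y where y: "0 < y" "y < \<epsilon>" using unb[OF \<epsilon>] by blast
      have "w (g y) \<le> y"
        using y by (intro is_lub_least[OF lub]) (force simp: E_def not_le[symmetric])
      then show ?thesis using y by (auto intro: le_less_trans)
    qed
  qed
qed

lemma ex_pole_of_unbounded_fun:
  assumes S: "dpred (\<lambda>v. S (v 0))" and g: "dterm (\<lambda>v. g (v 0))"
    and bdd: "\<And>y. S y \<Longrightarrow> p \<le> y" "\<And>y. S y \<Longrightarrow> y \<le> q"
    and unb: "\<And>t. \<exists>y. S y \<and> t < g y"
  shows "\<exists>\<tau> e. pole \<tau> e"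
proof -
  note [definable_intros] = definable_pred_unary[OF S] definable_term_unary[OF g]
  \<comment> \<open>The infimum \<open>s\<close> of all \<open>y\<close> up to which
    \<open>g\<close> is already unbounded is a point near which \<open>g\<close> takes arbitrarily
    large values.\<close>
  define U where "U y \<longleftrightarrow> (\<forall>t. \<exists>y'. S y' \<and> y' \<le> y \<and> t < g y')" for y
  have "dpred (\<lambda>v. U (v 0))" unfolding U_def by (intro definable_intros)
  moreover have "U q" unfolding U_def using unb bdd(2) by blast
  moreover have "p \<le> y" if "U y" for y using that bdd(1) unfolding U_def by (meson order_trans)
  ultimately obtain s where s: "is_glb {y. U y} s" using is_glb_glb by blast
  have both: "\<exists>y. e1 < y \<and> y < e2 \<and> S y \<and> t < g y" if e: "e1 < s" "s < e2" for e1 e2 t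
  proof -
    \<comment> \<open>Up to \<open>e1\<close> the function is bounded by \<open>t0\<close>, so a
      value above \<open>t0\<close> found below \<open>e2\<close> must occur to the right of
      \<open>e1\<close>.\<close>
    have "\<not> U e1" using s e(1) unfolding is_glb_def by auto
    then obtain t0 where t0: "\<And>y. S y \<Longrightarrow> y \<le> e1 \<Longrightarrow> \<not> t0 < g y" unfolding U_def by blast
    obtain e where "U e" "e < e2" using is_glb_less_iff[OF s] e(2) by auto
    then obtain y where "S y" "y \<le> e" "max t t0 < g y" unfolding U_def by blast
    then show ?thesis using t0[of y] \<open>e < e2\<close> by (intro exI[of _ y]) force
  qed
  show ?thesis
  proof (cases "\<forall>e>s. \<forall>t. \<exists>y. s < y \<and> y < e \<and> S y \<and> t < g y")
    case True
    show ?thesis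
    proof (rule ex_pole_of_unbounded_at_zero)
      show "dpred (\<lambda>v. S (s + v 0))" "dterm (\<lambda>v. g (s + v 0))" by (intro definable_intros)+
      fix e t :: 'a assume "0 < e"
      then have "s < s + e" by simp
      then obtain y where y: "s < y" "y < s + e" "S y" "t < g y" using True by blast
      have "0 < y - s" "y - s < e"
        using y by (simp_all add: ab.less_diff_eq ab.diff_less_eq add_commute[of e])
      moreover have "s + (y - s) = y" by (simp only: add_commute[of s] diff_add_cancel)
      ultimately
      show "\<exists>y. 0 < y \<and> y < e \<and> S (s + y) \<and> t < g (s + y)"
        using y by (intro exI[of _ "y - s"]) simp
    qed
  next
    case False
    then obtain e2 t2 where e2: "s < e2" "\<And>y. s < y \<Longrightarrow> y < e2 \<Longrightarrow> S y \<Longrightarrow> \<not> t2 < g y" by blast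
    show ?thesis
    proof (rule ex_pole_of_unbounded_at_zero)
      show "dpred (\<lambda>v. S (s - v 0))" "dterm (\<lambda>v. g (s - v 0))" by (intro definable_intros)+
      fix e t :: 'a assume "0 < e"
      then have "s - e < s" by (simp add: ab.diff_less_eq)
      \<comment> \<open>To the right of \<open>s\<close> the values stay at most \<open>t2\<close>.
        A value above both \<open>t2\<close> and \<open>g s\<close> therefore occurs to the left of
        \<open>s\<close>, and reflection at \<open>s\<close> moves it to the right of
        \<open>0\<close>.\<close>
      from both[OF this e2(1), of "max t (max t2 (g s))"]
      obtain y where y: "s - e < y" "y < e2" "S y" "t < g y" "t2 < g y" "g s < g y" by auto
      then have "y < s" using e2(2)[of y] by (metis less_irrefl linorder_neqE)
      have "0 < s - y" "s - y < e"
        using y \<open>y < s\<close> by (simp_all add: ab.less_diff_eq ab.diff_less_eq add_commute[of e])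
      moreover have "s - (s - y) = y" by (simp only: ab.diff_diff_eq2 add_commute[of s] add_diff_cancel)
      ultimately show "\<exists>y. 0 < y \<and> y < e \<and> S (s - y) \<and> t < g (s - y)"
        using y by (intro exI[of _ "s - y"]) simp
    qed
  qed
qed


section \<open>The group-valued metric\<close>

definition gabs :: "'a \<Rightarrow> 'a" where
  "gabs x = max x (- x)"

lemma gabs_less_iff: "gabs x < r \<longleftrightarrow> x < r \<and> - r < x"
  by (simp add: gabs_def ab.minus_less_iff)

lemma gabs_nonneg [simp]: "0 \<le> gabs x"
  by (cases "0 \<le> x") (auto simp: gabs_def le_max_iff_disj not_le)

lemma gabs_zero [simp]: "gabs 0 = 0"
  by (simp add: gabs_def)

lemma gabs_minus_commute: "gabs (x - y) = gabs (y - x)"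
  by (simp add: gabs_def max.commute)

lemma gabs_triangle: "gabs (x + y) \<le> gabs x + gabs y"
proof -
  have "- (x + y) = - x + - y" by (simp only: minus_add add_commute)
  moreover have "x + y \<le> max x (- x) + max y (- y)" by (rule ab.add_mono; simp)
  moreover have "- x + - y \<le> max x (- x) + max y (- y)" by (rule ab.add_mono; simp)
  ultimately show ?thesis by (simp only: gabs_def max.bounded_iff)
qed

lemma dterm_gabs [definable_intros]: "dterm t \<Longrightarrow> dterm (\<lambda>v. gabs (t v))"
  unfolding gabs_def by (intro definable_intros)

primrec gdist :: "nat \<Rightarrow> (nat \<Rightarrow> 'a) \<Rightarrow> (nat \<Rightarrow> 'a) \<Rightarrow> 'a" where
  "gdist 0 x y = 0"
| "gdist (Suc n) x y = max (gdist n x y) (gabs (x n - y n))"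

lemma gdist_less_iff: "gdist n x y < r \<longleftrightarrow> 0 < r \<and> (\<forall>i<n. gabs (x i - y i) < r)"
  by (induction n) (auto simp: less_Suc_eq)

lemma gdist_nonneg [simp]: "0 \<le> gdist n x y"
  by (induction n) (auto simp: le_max_iff_disj)

lemma gdist_self [simp]: "gdist n x x = 0"
  by (induction n) auto

lemma gdist_commute: "gdist n x y = gdist n y x"
  by (induction n) (auto simp: gabs_minus_commute)

lemma gdist_triangle: "gdist n x z \<le> gdist n x y + gdist n y z"
proof (induction n)
  case (Suc n)
  have "gabs (x n - z n) \<le> gabs (x n - y n) + gabs (y n - z n)"
    using gabs_triangle[of "x n - y n" "y n - z n"] by (simp add: add_diff_eq)
  also have "\<dots> \<le> gdist (Suc n) x y + gdist (Suc n) y z"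
    by (intro ab.add_mono) simp_all
  finally have "gabs (x n - z n) \<le> gdist (Suc n) x y + gdist (Suc n) y z" .
  moreover have "gdist n x y + gdist n y z \<le> gdist (Suc n) x y + gdist (Suc n) y z"
    by (intro ab.add_mono) simp_all
  ultimately show ?case using Suc by simp
qed simp

lemma dterm_gdist [definable_intros]:
  assumes "\<And>i. i < n \<Longrightarrow> dterm (\<lambda>v. x v i)" "\<And>i. i < n \<Longrightarrow> dterm (\<lambda>v. y v i)"
  shows "dterm (\<lambda>v. gdist n (x v) (y v))"
  using assms
proof (induction n)
  case 0
  then show ?case by (simp add: definable_intros)
next
  case (Suc n)
  then show ?case unfolding gdist.simps by (intro definable_intros) auto
qed

lemma openin_ball: "openin (cart_topology n) {y \<in> cart_power n. gdist n y x < r}"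
proof (cases "0 < r")
  case True
  have "gabs (a - b) < r \<longleftrightarrow> a \<in> {b - r<..<b + r}" for a b
    by (simp add: gabs_less_iff ab.diff_less_eq ab.less_diff_eq add_commute) (metis ab.diff_less_eq add_commute)
  then have "{y \<in> cart_power n. gdist n y x < r} = (\<Pi>\<^sub>E i\<in>{..<n}. {x i - r<..<x i + r})"
    using True by (auto simp: gdist_less_iff PiE_iff extensional_def)
  then show ?thesis by (simp add: openin_PiE)
next
  case False
  then show ?thesis by (simp add: gdist_less_iff)
qed

lemma common_radius:
  assumes "\<And>i. i < (n::nat) \<Longrightarrow> \<exists>r>0. P i r" "\<And>i r s. P i r \<Longrightarrow> s \<le> r \<Longrightarrow> P i s"
  shows "\<exists>r>0. \<forall>i<n. P i (r::'a)"
  using assms(1)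
proof (induction n)
  case 0
  obtain u :: 'a where "0 < u" by (rule exists_pos)
  then show ?case by auto
next
  case (Suc n)
  obtain r where r: "0 < r" "\<And>i. i < n \<Longrightarrow> P i r" using Suc.IH Suc.prems by (meson less_SucI)
  obtain s where s: "0 < s" "P n s" using Suc.prems by blast
  have "P i (min r s)" if "i < Suc n" for i
    using that r(2)[of i] s(2) assms(2) by (cases "i = n") (auto intro: min.cobounded1 min.cobounded2)
  then show ?case using r s by (intro exI[of _ "min r s"]) simp
qed

lemma open_radius:
  assumes "open V" "a \<in> V"
  obtains r :: 'a where "0 < r" "\<And>b. gabs (b - a) < r \<Longrightarrow> b \<in> V"
proof -
  obtain u where u: "a < u" "{a..<u} \<subseteq> V" using open_right[OF assms] gt_ex by meson
  obtain l where l: "l < a" "{l<..a} \<subseteq> V" using open_left[OF assms] lt_ex by meson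
  show ?thesis
  proof
    show "0 < min (u - a) (a - l)" using u l by (simp add: ab.less_diff_eq)
    fix b assume "gabs (b - a) < min (u - a) (a - l)"
    then have "b - a < u - a" "- (a - l) < b - a" by (auto simp: gabs_less_iff ab.minus_less_iff)
    then have "b < u" "l < b" by (simp_all add: ab.diff_less_eq)
    then show "b \<in> V" using u l by (cases "a \<le> b") auto
  qed
qed

text \<open>The product order topology is the topology of the maximum metric \<open>gdist\<close>;
  the continuity proofs for the extension then work with balls of this metric.\<close>

lemma openin_cart_iff:
  "openin (cart_topology n) U \<longleftrightarrow>
     U \<subseteq> cart_power n \<and> (\<forall>x\<in>U. \<exists>r>0. \<forall>y\<in>cart_power n. gdist n y x < r \<longrightarrow> y \<in> U)"
proof
  assume U: "openin (cart_topology n) U"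
  then have sub: "U \<subseteq> cart_power n" using openin_subset by fastforce
  moreover have "\<exists>r>0. \<forall>y\<in>cart_power n. gdist n y x < r \<longrightarrow> y \<in> U" if x: "x \<in> U" for x
  proof -
    have "\<exists>V. (\<forall>i\<in>{..<n}. openin euclidean (V i)) \<and> x \<in> Pi\<^sub>E {..<n} V \<and> Pi\<^sub>E {..<n} V \<subseteq> U"
      using U x unfolding openin_product_topology_alt by blast
    then obtain V where V: "\<And>i. i < n \<Longrightarrow> open (V i)" "x \<in> Pi\<^sub>E {..<n} V" "Pi\<^sub>E {..<n} V \<subseteq> U"
      by auto
    have "\<exists>r>0. \<forall>i<n. \<forall>b. gabs (b - x i) < r \<longrightarrow> b \<in> V i"
    proof (rule common_radius)
      fix i assume "i < n"
      then show "\<exists>r>0. \<forall>b. gabs (b - x i) < r \<longrightarrow> b \<in> V i"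
        using open_radius[OF V(1), of i "x i"] V(2) by (metis PiE_mem lessThan_iff)
    qed (meson less_le_trans)
    then obtain r where r: "0 < r" "\<And>i b. i < n \<Longrightarrow> gabs (b - x i) < r \<Longrightarrow> b \<in> V i" by blast
    show ?thesis
    proof (intro exI[of _ r] conjI r(1) ballI impI)
      fix y assume "y \<in> cart_power n" "gdist n y x < r"
      then have "y \<in> Pi\<^sub>E {..<n} V" using r by (auto simp: gdist_less_iff PiE_iff)
      then show "y \<in> U" using V by blast
    qed
  qed
  ultimately show "U \<subseteq> cart_power n \<and> (\<forall>x\<in>U. \<exists>r>0. \<forall>y\<in>cart_power n. gdist n y x < r \<longrightarrow> y \<in> U)"
    by blast
next
  assume U: "U \<subseteq> cart_power n \<and> (\<forall>x\<in>U. \<exists>r>0. \<forall>y\<in>cart_power n. gdist n y x < r \<longrightarrow> y \<in> U)"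
  have "\<exists>T. openin (cart_topology n) T \<and> x \<in> T \<and> T \<subseteq> U" if x: "x \<in> U" for x
  proof -
    obtain r where "0 < r" "\<forall>y\<in>cart_power n. gdist n y x < r \<longrightarrow> y \<in> U" using U x by blast
    then show ?thesis using U x openin_ball[of n x r]
      by (intro exI[of _ "{y \<in> cart_power n. gdist n y x < r}"]) auto
  qed
  then show "openin (cart_topology n) U" using openin_subopen by metis
qed

lemma continuous_map_ball:
  assumes f: "continuous_map (subtopology (cart_topology n) A) euclidean f"
    and A: "A \<subseteq> cart_power n" "x \<in> A" and U: "open U" "f x \<in> U"
  obtains r where "0 < r" "\<And>y. y \<in> A \<Longrightarrow> gdist n y x < r \<Longrightarrow> f y \<in> U"
proof -
  have "openin (subtopology (cart_topology n) A) {y \<in> topspace (subtopology (cart_topology n) A). f y \<in> U}"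
    using openin_continuous_map_preimage[OF f] U by simp
  then obtain T where T: "openin (cart_topology n) T"
      "{y \<in> topspace (subtopology (cart_topology n) A). f y \<in> U} = T \<inter> A"
    unfolding openin_subtopology by blast
  have "topspace (subtopology (cart_topology n) A) = A" using A by auto
  then have TA: "{y \<in> A. f y \<in> U} = T \<inter> A" using T(2) by simp
  then have "x \<in> T" using A U by blast
  then obtain r where r: "0 < r" "\<forall>y\<in>cart_power n. gdist n y x < r \<longrightarrow> y \<in> T"
    using T(1) unfolding openin_cart_iff by metis
  have "f y \<in> U" if "y \<in> A" "gdist n y x < r" for y
  proof -
    have "y \<in> T \<inter> A" using r(2) that A(1) by auto
    then show ?thesis unfolding TA[symmetric] by simp
  qed
  then show ?thesis using that r(1) by metis
qed


section \<open>From poles to extensions\<close>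

text \<open>Think of \<open>\<Lambda> \<delta> t\<close> as the search radius around a point at distance \<open>\<delta>\<close> from the given closed set.
  The radius varies with \<open>t\<close> over a whole line, however small \<open>\<delta>\<close> is; this is what a pole makes
  possible.\<close>

definition modulus :: "('a \<Rightarrow> 'a \<Rightarrow> 'a) \<Rightarrow> bool" where
  "modulus \<Lambda> \<longleftrightarrow> dterm (\<lambda>v. \<Lambda> (v 0) (v 1)) \<and>
     (\<forall>\<delta> t. 0 < \<delta> \<longrightarrow> 0 < t \<longrightarrow> \<delta> < \<Lambda> \<delta> t \<and> \<Lambda> \<delta> t \<le> \<delta> + \<delta>) \<and>
     (\<forall>\<delta> s t. 0 < \<delta> \<longrightarrow> 0 < s \<longrightarrow> s < t \<longrightarrow> \<Lambda> \<delta> s < \<Lambda> \<delta> t) \<and>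
     (\<forall>\<delta> \<delta>' t. 0 < \<delta> \<longrightarrow> \<delta> \<le> \<delta>' \<longrightarrow> 0 < t \<longrightarrow> \<Lambda> \<delta> t \<le> \<Lambda> \<delta>' t) \<and>
     (\<forall>\<delta> t r. 0 < \<delta> \<longrightarrow> 0 < t \<longrightarrow> r < \<Lambda> \<delta> t \<longrightarrow> (\<exists>\<delta>'>0. \<delta>' < \<delta> \<and> r < \<Lambda> \<delta>' t)) \<and>
     (\<forall>\<delta> t r. 0 < \<delta> \<longrightarrow> 0 < t \<longrightarrow> \<Lambda> \<delta> t < r \<longrightarrow> (\<exists>\<delta>'>\<delta>. \<Lambda> \<delta>' t < r))"

text \<open>The bounds below and above make the search for points of the closed set successful and
  local. Strict growth in \<open>t\<close> makes the search condition monotone. Monotonicity and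
  one-sided continuity in \<open>\<delta>\<close> let it survive small moves of the point.\<close>

lemma modulusD:
  assumes "modulus \<Lambda>"
  shows "dterm (\<lambda>v. \<Lambda> (v 0) (v 1))"
    and "0 < \<delta> \<Longrightarrow> 0 < t \<Longrightarrow> \<delta> < \<Lambda> \<delta> t"
    and "0 < \<delta> \<Longrightarrow> 0 < t \<Longrightarrow> \<Lambda> \<delta> t \<le> \<delta> + \<delta>"
    and "0 < \<delta> \<Longrightarrow> 0 < s \<Longrightarrow> s < t \<Longrightarrow> \<Lambda> \<delta> s < \<Lambda> \<delta> t"
    and "0 < \<delta> \<Longrightarrow> \<delta> \<le> \<delta>' \<Longrightarrow> 0 < t \<Longrightarrow> \<Lambda> \<delta> t \<le> \<Lambda> \<delta>' t"
    and "0 < \<delta> \<Longrightarrow> 0 < t \<Longrightarrow> r < \<Lambda> \<delta> t \<Longrightarrow> \<exists>\<delta>'>0. \<delta>' < \<delta> \<and> r < \<Lambda> \<delta>' t"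
    and "0 < \<delta> \<Longrightarrow> 0 < t \<Longrightarrow> \<Lambda> \<delta> t < r \<Longrightarrow> \<exists>\<delta>'>\<delta>. \<Lambda> \<delta>' t < r"
  using assms unfolding modulus_def by simp_all

text \<open>The pole conjugates translation by \<open>s\<close> to a strictly increasing map
  \<open>\<phi> s\<close> of \<open>(0, e)\<close> into itself with \<open>\<phi> s d < d\<close>.
  As \<open>t\<close> grows, \<open>\<rho> t\<close> decreases and hence
  \<open>\<phi> (\<rho> t) d\<close> increases. Continuity in \<open>d\<close> comes from strict
  monotonicity together with the range being an initial segment.\<close>

lemma ex_modulus:
  assumes "pole \<tau> e"
  shows "\<exists>\<Lambda>. modulus \<Lambda>"
proof -
  have dt: "dterm (\<lambda>v. \<tau> (v 0))" and e: "0 < e"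
    and decr: "\<And>x y. 0 < x \<Longrightarrow> x < y \<Longrightarrow> y < e \<Longrightarrow> \<tau> y < \<tau> x"
    and img: "\<tau> ` {0<..<e} = {0<..}"
    using assms unfolding pole_def by simp_all
  note [definable_intros] = definable_term_unary[OF dt]
  \<comment> \<open>For positive \<open>s\<close> this is the infimum of a one-point set, which
    presents the inverse of \<open>\<tau>\<close> as a definable term.\<close>
  define \<rho> where "\<rho> s = glb {x. 0 < x \<and> x < e \<and> \<tau> x = s}" for s
  have d\<rho>: "dterm (\<lambda>v. \<rho> (v 0))" unfolding \<rho>_def by (intro definable_intros)
  note [definable_intros] = definable_term_unary[OF d\<rho>]
  have \<tau>_pos: "0 < \<tau> x" if "0 < x" "x < e" for x
  proof -
    have "\<tau> x \<in> \<tau> ` {0<..<e}" using that by simp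
    then show ?thesis unfolding img by simp
  qed
  have \<tau>_less: "x < y" if "\<tau> y < \<tau> x" "0 < x" "x < e" "0 < y" "y < e" for x y
    using decr[of y x] that by (metis less_asym linorder_neqE less_irrefl)
  have \<rho>\<tau>: "\<rho> (\<tau> x) = x" if "0 < x" "x < e" for x
  proof -
    have "y = x" if y: "0 < y" "y < e" "\<tau> y = \<tau> x" for y
      using decr[of x y] decr[of y x] that \<open>0 < x\<close> \<open>x < e\<close> by (metis linorder_neqE less_irrefl)
    then have "{y. 0 < y \<and> y < e \<and> \<tau> y = \<tau> x} = {x}" using that by auto
    then show ?thesis unfolding \<rho>_def by (intro glb_eq) (simp add: is_glb_def)
  qed
  have \<rho>: "0 < \<rho> s" "\<rho> s < e" "\<tau> (\<rho> s) = s" if "0 < s" for s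
  proof -
    have "s \<in> \<tau> ` {0<..<e}" unfolding img using that by simp
    then obtain x where "0 < x" "x < e" "s = \<tau> x" by auto
    then show "0 < \<rho> s" "\<rho> s < e" "\<tau> (\<rho> s) = s" using \<rho>\<tau> by auto
  qed
  have \<rho>_decr: "\<rho> t < \<rho> s" if "0 < s" "s < t" for s t
    using \<tau>_less[of "\<rho> s" "\<rho> t"] \<rho>[of s] \<rho>[of t] that by simp
  obtain e' where e': "0 < e'" "e' < e" using dense[OF e] by blast
  define \<phi> where "\<phi> s d = \<rho> (\<tau> d + s)" for s d
  have \<tau>s: "0 < \<tau> d + s" "\<tau> d < \<tau> d + s" if "0 < d" "d < e" "0 < s" for d s
    using \<tau>_pos[of d] that by (simp_all add: ab.add_pos_pos)
  have \<phi>_pos: "0 < \<phi> s d" and \<phi>_e: "\<phi> s d < e" and \<tau>\<phi>: "\<tau> (\<phi> s d) = \<tau> d + s" and \<phi>_less: "\<phi> s d < d"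
    if "0 < d" "d < e" "0 < s" for s d
    using \<rho>[of "\<tau> d + s"] \<tau>s[OF that] \<rho>_decr[of "\<tau> d" "\<tau> d + s"] \<rho>\<tau>[of d] \<tau>_pos[of d] that
    unfolding \<phi>_def by simp_all
  have \<phi>_mono: "\<phi> s d < \<phi> s d'" if "0 < d" "d < d'" "d' < e" "0 < s" for s d d'
    using \<rho>_decr[of "\<tau> d' + s" "\<tau> d + s"] decr[of d d'] \<tau>s(1)[of d' s] that
    by (simp add: \<phi>_def ab.add_strict_right_mono)
  have \<phi>_anti: "\<phi> s' d < \<phi> s d" if "0 < d" "d < e" "0 < s" "s < s'" for s s' d
    using \<rho>_decr[of "\<tau> d + s" "\<tau> d + s'"] \<tau>s(1)[of d s] that by (simp add: \<phi>_def)
  \<comment> \<open>The range of \<open>\<phi> s\<close> is closed downwards. The preimage of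
    \<open>a\<close> solves \<open>\<tau> d = \<tau> a - s\<close>, and the right side is positive
    because it exceeds \<open>\<tau> d'\<close>.\<close>
  have \<phi>_surj: "\<exists>d. 0 < d \<and> d < e \<and> \<phi> s d = a" if "0 < a" "a < \<phi> s d'" "0 < d'" "d' < e" "0 < s" for a s d'
  proof -
    have "a < e" using that \<phi>_e[of d' s] by auto
    have "\<tau> d' + s < \<tau> a" using decr[OF that(1,2)] \<phi>_e[of d' s] \<tau>\<phi>[of d' s] that by simp
    then have "\<tau> d' < \<tau> a - s" by (simp add: ab.less_diff_eq)
    then have pos: "0 < \<tau> a - s" using \<tau>_pos[OF that(3,4)] by (rule order.strict_trans[rotated])
    have "\<phi> s (\<rho> (\<tau> a - s)) = a" using \<rho>[OF pos] \<rho>\<tau>[of a] that \<open>a < e\<close> by (simp add: \<phi>_def)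
    then show ?thesis using \<rho>[OF pos] by blast
  qed
  \<comment> \<open>Beyond \<open>e' < e\<close> the added term is frozen, so that
    \<open>\<phi>\<close> is used only inside its domain while \<open>\<delta>\<close> ranges over
    all positive elements.\<close>
  define \<Lambda> where "\<Lambda> \<delta> t = \<delta> + \<phi> (\<rho> t) (min \<delta> e')" for \<delta> t
  have "modulus \<Lambda>"
    unfolding modulus_def
  proof (intro conjI allI impI)
    show "dterm (\<lambda>v. \<Lambda> (v 0) (v 1))" unfolding \<Lambda>_def \<phi>_def by (intro definable_intros)
  next
    fix \<delta> t :: 'a assume pos: "0 < \<delta>" "0 < t"
    then have m: "0 < min \<delta> e'" "min \<delta> e' < e" using e' by (auto simp: min_less_iff_disj)
    show "\<delta> < \<Lambda> \<delta> t" using \<phi>_pos[OF m \<rho>(1)[OF pos(2)]] by (simp add: \<Lambda>_def)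
    show "\<Lambda> \<delta> t \<le> \<delta> + \<delta>" using \<phi>_less[OF m \<rho>(1)[OF pos(2)]] by (simp add: \<Lambda>_def less_imp_le)
  next
    fix \<delta> s t :: 'a assume pos: "0 < \<delta>" "0 < s" "s < t"
    then have m: "0 < min \<delta> e'" "min \<delta> e' < e" "0 < t" using e' by (auto simp: min_less_iff_disj)
    show "\<Lambda> \<delta> s < \<Lambda> \<delta> t"
      using \<phi>_anti[OF m(1,2) \<rho>(1)[OF m(3)] \<rho>_decr] pos by (simp add: \<Lambda>_def)
  next
    fix \<delta> \<delta>' t :: 'a assume pos: "0 < \<delta>" "\<delta> \<le> \<delta>'" "0 < t"
    then have m: "0 < min \<delta> e'" "min \<delta> e' \<le> min \<delta>' e'" "min \<delta>' e' < e" using e' by (auto simp: min_less_iff_disj min_le_iff_disj)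
    have "\<phi> (\<rho> t) (min \<delta> e') \<le> \<phi> (\<rho> t) (min \<delta>' e')"
      using \<phi>_mono[OF m(1) _ m(3) \<rho>(1)[OF pos(3)]] m(2) by (cases "min \<delta> e' = min \<delta>' e'") (auto simp: le_less)
    then show "\<Lambda> \<delta> t \<le> \<Lambda> \<delta>' t" unfolding \<Lambda>_def using pos(2) by (rule ab.add_mono[rotated])
  next
    fix \<delta> t r assume pos: "0 < \<delta>" "0 < t" and r: "r < \<Lambda> \<delta> t"
    then have m: "0 < min \<delta> e'" "min \<delta> e' < e" using e' by (auto simp: min_less_iff_disj)
    define s where "s = \<rho> t"
    have s: "0 < s" using \<rho>(1) pos s_def by simp
    have "max 0 (r - \<delta>) < \<phi> s (min \<delta> e')"
      using \<phi>_pos[OF m s] r by (simp add: \<Lambda>_def s_def ab.diff_less_eq add_commute)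
    \<comment> \<open>The value \<open>a\<close> lies just below the added term, and
      \<open>d\<close> is its preimage. Any \<open>\<delta>'\<close> below \<open>\<delta>\<close>
      but above both \<open>d\<close> and \<open>r - a\<close> keeps the sum above
      \<open>r\<close>.\<close>
    then obtain a where a: "max 0 (r - \<delta>) < a" "a < \<phi> s (min \<delta> e')" using dense by blast
    obtain d where d: "0 < d" "d < e" "\<phi> s d = a" using \<phi>_surj[OF _ a(2) m s] a(1) by auto
    have "d < min \<delta> e'"
      using \<phi>_mono[OF m(1) _ d(2) s] d(3) a(2) by (metis less_asym linorder_neqE less_irrefl)
    moreover have "r - a < \<delta>" using a(1) by (simp add: ab.diff_less_eq add_commute)
    ultimately have "max d (r - a) < \<delta>" by simp
    then obtain \<delta>' where \<delta>': "max d (r - a) < \<delta>'" "\<delta>' < \<delta>" using dense by blast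
    have "a < \<phi> s (min \<delta>' e')"
      using \<phi>_mono[OF d(1) _ _ s, of "min \<delta>' e'"] d(3) \<delta>' \<open>d < min \<delta> e'\<close> e'
      by (auto simp: min_less_iff_disj)
    moreover have "r < \<delta>' + a" using \<delta>' by (simp add: ab.diff_less_eq)
    ultimately have "r < \<delta>' + \<phi> s (min \<delta>' e')" by (meson ab.add_strict_left_mono order.strict_trans)
    then show "\<exists>\<delta>'>0. \<delta>' < \<delta> \<and> r < \<Lambda> \<delta>' t"
      using \<delta>' d(1) by (intro exI[of _ \<delta>']) (auto simp: \<Lambda>_def s_def)
  next
    fix \<delta> t r assume pos: "0 < \<delta>" "0 < t" and r: "\<Lambda> \<delta> t < r"
    then have m: "0 < min \<delta> e'" "min \<delta> e' < e" using e' by (auto simp: min_less_iff_disj)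
    define s where "s = \<rho> t"
    have s: "0 < s" using \<rho>(1) pos s_def by simp
    have r': "\<phi> s (min \<delta> e') < r - \<delta>"
      using r by (simp add: \<Lambda>_def s_def ab.less_diff_eq add_commute)
    show "\<exists>\<delta>'>\<delta>. \<Lambda> \<delta>' t < r"
    proof (cases "\<delta> < e'")
      case False
      \<comment> \<open>Here the added term is constant to the right of \<open>\<delta>\<close>, so
        only the first summand moves.\<close>
      have "\<delta> < r - \<phi> s e'" using r False by (simp add: \<Lambda>_def s_def ab.less_diff_eq min_def split: if_splits)
      then obtain \<delta>' where \<delta>': "\<delta> < \<delta>'" "\<delta>' < r - \<phi> s e'" using dense by blast
      moreover have "e' \<le> \<delta>'" using False \<delta>'(1) by order
      then have "min \<delta>' e' = e'" by (rule min.absorb2)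
      ultimately have "\<Lambda> \<delta>' t < r" by (simp add: \<Lambda>_def s_def ab.less_diff_eq)
      then show ?thesis using \<delta>' by blast
    next
      case True
      then have "\<phi> s \<delta> < min (r - \<delta>) (\<phi> s e')" using r' \<phi>_mono[OF pos(1) True e'(2) s] by simp
      \<comment> \<open>This mirrors the previous case; staying below \<open>\<phi> s e'\<close>
        keeps \<open>a\<close> in the range of \<open>\<phi> s\<close>.\<close>
      then obtain a where a: "\<phi> s \<delta> < a" "a < min (r - \<delta>) (\<phi> s e')" using dense by blast
      have "0 < \<phi> s \<delta>" using \<phi>_pos[of \<delta> s] pos True e' s by simp
      then have "0 < a" using a(1) by simp
      then obtain d where d: "0 < d" "d < e" "\<phi> s d = a" using \<phi>_surj[OF _ _ e' s] a(2) by auto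
      have "\<delta> < d"
        using \<phi>_mono[OF d(1) _ _ s, of \<delta>] d(3) a(1) True e' by (metis less_asym linorder_neqE less_irrefl order.strict_trans)
      moreover have "\<delta> < r - a" using a(2) by (simp add: ab.less_diff_eq add_commute)
      ultimately have "\<delta> < min (min d e') (r - a)" using True by simp
      then obtain \<delta>' where \<delta>': "\<delta> < \<delta>'" "\<delta>' < min (min d e') (r - a)" using dense by blast
      have "\<phi> s \<delta>' < a"
        using \<phi>_mono[OF _ _ d(2) s, of \<delta>'] d(3) \<delta>' pos(1) by auto
      moreover have "\<delta>' + a < r" using \<delta>' by (simp add: ab.less_diff_eq)
      ultimately have "\<delta>' + \<phi> s \<delta>' < r" by (meson ab.add_strict_left_mono order.strict_trans)
      moreover have "\<delta>' \<le> e'" using \<delta>'(2) by (simp add: less_imp_le)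
      then have "min \<delta>' e' = \<delta>'" by (rule min.absorb1)
      ultimately have "\<Lambda> \<delta>' t < r" by (simp add: \<Lambda>_def s_def)
      then show ?thesis using \<delta>' by blast
    qed
  qed
  then show ?thesis by blast
qed


section \<open>Definable functions and the distance to a closed set\<close>

definition dfun :: "nat \<Rightarrow> ((nat \<Rightarrow> 'a) \<Rightarrow> 'a) \<Rightarrow> bool" where
  "dfun n f \<longleftrightarrow> dterm (\<lambda>v. f (restrict v {..<n}))"

lemma dfun_comp:
  assumes "dfun n f" "\<And>i. i < n \<Longrightarrow> dterm (\<lambda>v. x v i)"
  shows "dterm (\<lambda>v. f (restrict (x v) {..<n}))"
  by (rule definable_term_comp[where n = n and s = x, OF assms(1)[unfolded dfun_def]])
    (auto intro!: arg_cong[of _ _ f] restrict_ext assms(2))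

lemma definable_comp:
  assumes "definable \<M> n A" "\<And>i. i < n \<Longrightarrow> dterm (\<lambda>v. x v i)"
  shows "dpred (\<lambda>v. restrict (x v) {..<n} \<in> A)"
proof (rule definable_pred_comp[where n = n and s = x, OF definable_pred_restrict_mem[OF assms(1)]])
  fix v w :: "nat \<Rightarrow> 'a"
  assume "\<And>k. k < n \<Longrightarrow> v k = w k" "restrict v {..<n} \<in> A"
  moreover from this(1) have "restrict v {..<n} = restrict w {..<n}" by (auto intro: restrict_ext)
  ultimately show "restrict w {..<n} \<in> A" by simp
qed (rule assms(2))

text \<open>The graph in \<open>definable_fun\<close> determines \<open>f\<close> on
  \<open>A\<close> only; the value \<open>0\<close> elsewhere turns it into a definable
  term.\<close>

lemma dfun_of_definable_fun:
  assumes A: "definable \<M> n A" and f: "definable_fun \<M> n A f"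
  shows "dfun n (\<lambda>x. if x \<in> A then f x else 0)"
proof -
  define G where "G = {x \<in> cart_power (Suc n). restrict x {..<n} \<in> A \<and> x n = f (restrict x {..<n})}"
  have G: "definable \<M> (Suc n) G" using f unfolding definable_fun_def G_def .
  have "dpred (\<lambda>v. restrict (\<lambda>k. if k = n then v 0 else v (Suc k)) {..<Suc n} \<in> G)"
  proof (rule definable_comp[OF G])
    show "dterm (\<lambda>v. if i = n then v 0 else v (Suc i))" for i
      by (cases "i = n") (simp_all add: definable_term_var)
  qed
  moreover have "restrict (\<lambda>k. if k = n then v 0 else v (Suc k)) {..<Suc n} \<in> G \<longleftrightarrow>
      restrict (\<lambda>k. v (Suc k)) {..<n} \<in> A \<and> v 0 = f (restrict (\<lambda>k. v (Suc k)) {..<n})" for v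
  proof -
    have "restrict (restrict (\<lambda>k. if k = n then v 0 else v (Suc k)) {..<Suc n}) {..<n} =
        restrict (\<lambda>k. v (Suc k)) {..<n}"
      by (auto simp: fun_eq_iff)
    then show ?thesis by (simp add: G_def)
  qed
  ultimately have 1: "dpred (\<lambda>v. restrict (\<lambda>k. v (Suc k)) {..<n} \<in> A \<and>
      v 0 = f (restrict (\<lambda>k. v (Suc k)) {..<n}))" by simp
  have 2: "dpred (\<lambda>v. restrict (\<lambda>k. v (Suc k)) {..<n} \<in> A)"
    by (intro definable_comp[OF A] definable_intros)
  have "dpred (\<lambda>v. (restrict (\<lambda>k. v (Suc k)) {..<n} \<in> A \<and> v 0 = f (restrict (\<lambda>k. v (Suc k)) {..<n}))
      \<or> (\<not> restrict (\<lambda>k. v (Suc k)) {..<n} \<in> A \<and> v 0 = 0))"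
    by (intro definable_pred_disj[OF 1] definable_pred_conj definable_pred_Not[OF 2] definable_intros)
  moreover have "(restrict (\<lambda>k. v (Suc k)) {..<n} \<in> A \<and> v 0 = f (restrict (\<lambda>k. v (Suc k)) {..<n}))
      \<or> (\<not> restrict (\<lambda>k. v (Suc k)) {..<n} \<in> A \<and> v 0 = 0) \<longleftrightarrow>
      v 0 = (if restrict (\<lambda>k. v (Suc k)) {..<n} \<in> A then f (restrict (\<lambda>k. v (Suc k)) {..<n}) else 0)" for v
    by auto
  ultimately show ?thesis unfolding dfun_def definable_term_def by simp
qed

lemma definable_fun_of_dfun:
  assumes "dfun n F"
  shows "definable_fun \<M> n (cart_power n) F"
proof -
  have "dpred (\<lambda>v. v n = F (restrict v {..<n}))"
    by (intro definable_intros dfun_comp[OF assms])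
  from definable_Collect[OF this, of "Suc n"]
  show ?thesis unfolding definable_fun_def by simp
qed

text \<open>The distance to \<open>A\<close> is an infimum quantified over
  \<open>cart_power n\<close>, the shape to which \<open>definable_pred_ex_cart\<close>
  applies.\<close>

definition gsetdist :: "nat \<Rightarrow> (nat \<Rightarrow> 'a) set \<Rightarrow> (nat \<Rightarrow> 'a) \<Rightarrow> 'a" where
  "gsetdist n A x = glb {r. \<exists>a\<in>cart_power n. a \<in> A \<and> r = gdist n x a}"

lemma dterm_restrict:
  "i < n \<Longrightarrow> dterm (\<lambda>v. x v i) \<Longrightarrow> dterm (\<lambda>v. restrict (x v) {..<n} i)"
  by simp

context
  fixes n :: nat and A :: "(nat \<Rightarrow> 'a) set"
  assumes dA: "definable \<M> n A" and cA: "closedin (cart_topology n) A" and neA: "A \<noteq> {}"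
begin

lemma A_subset: "A \<subseteq> cart_power n"
  using closedin_subset[OF cA] by simp

lemma is_glb_gsetdist: "is_glb {r. \<exists>a\<in>A. r = gdist n x a} (gsetdist n A x)"
proof -
  have "dpred (\<lambda>v. \<exists>a\<in>cart_power n. a \<in> A \<and> v 0 = gdist n x a)"
    by (intro definable_pred_ex_cart definable_intros definable_comp[OF dA] dterm_restrict)
  moreover obtain a where "a \<in> A" using neA by blast
  ultimately have "is_glb {r. \<exists>a\<in>cart_power n. a \<in> A \<and> r = gdist n x a} (gsetdist n A x)"
    unfolding gsetdist_def using A_subset by (intro is_glb_glb[where a = "gdist n x a" and l = 0]) auto
  moreover have "{r. \<exists>a\<in>cart_power n. a \<in> A \<and> r = gdist n x a} = {r. \<exists>a\<in>A. r = gdist n x a}"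
    using A_subset by auto
  ultimately show ?thesis by simp
qed

lemma gsetdist_less_iff: "gsetdist n A x < r \<longleftrightarrow> (\<exists>a\<in>A. gdist n x a < r)"
  using is_glb_less_iff[OF is_glb_gsetdist] by blast

lemma gsetdist_le: "a \<in> A \<Longrightarrow> gsetdist n A x \<le> gdist n x a"
  using is_glb_gsetdist unfolding is_glb_def by blast

lemma gsetdist_triangle: "gsetdist n A y \<le> gsetdist n A x + gdist n y x"
proof (rule ccontr)
  assume "\<not> ?thesis"
  then have "gsetdist n A x < gsetdist n A y - gdist n y x" by (simp add: ab.less_diff_eq)
  then obtain a where a: "a \<in> A" "gdist n x a < gsetdist n A y - gdist n y x"
    using gsetdist_less_iff by blast
  have "gsetdist n A y \<le> gdist n y x + gdist n x a"
    using gsetdist_le[OF a(1)] gdist_triangle by (rule order_trans)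
  then show False using a(2) by (simp add: ab.less_diff_eq add_commute)
qed

lemma complement_radius:
  assumes "x \<in> cart_power n" "x \<notin> A"
  obtains r where "0 < r" "\<And>y. y \<in> cart_power n \<Longrightarrow> gdist n y x < r \<Longrightarrow> y \<notin> A"
proof -
  have "openin (cart_topology n) (cart_power n - A)"
    using cA by (simp add: closedin_def)
  then have "\<exists>r>0. \<forall>y\<in>cart_power n. gdist n y x < r \<longrightarrow> y \<in> cart_power n - A"
    using assms unfolding openin_cart_iff by blast
  then show ?thesis using that by auto
qed

lemma gsetdist_pos:
  assumes "x \<in> cart_power n" "x \<notin> A"
  shows "0 < gsetdist n A x"
proof -
  obtain r where r: "0 < r" "\<And>y. y \<in> cart_power n \<Longrightarrow> gdist n y x < r \<Longrightarrow> y \<notin> A"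
    using complement_radius[OF assms] by blast
  then have "\<not> gsetdist n A x < r"
    using A_subset by (auto simp: gsetdist_less_iff gdist_commute)
  then show ?thesis using r(1) by simp
qed

lemma dterm_gsetdist:
  assumes "\<And>i. i < n \<Longrightarrow> dterm (\<lambda>v. x v i)"
  shows "dterm (\<lambda>v. gsetdist n A (x v))"
proof -
  have "dterm (\<lambda>v. x (\<lambda>k. v (\<sigma> k)) i)" if "i < n" for i \<sigma>
    by (rule definable_term_shift[OF assms[OF that]])
  then show ?thesis
    unfolding gsetdist_def
    by (intro definable_intros definable_pred_ex_cart definable_comp[OF dA] dterm_restrict)
qed

end


text \<open>\<open>N x t\<close> says that the search from \<open>x\<close> with threshold
  \<open>t\<close> succeeds. Continuity of the infimum \<open>F\<close> of successful thresholds
  splits into a squeeze at points of \<open>A\<close> and separate upper and lower estimates at the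
  points outside, which form an open set.\<close>

lemma tietze_nonneg:
  assumes mod: "modulus \<Lambda>"
    and dA: "definable \<M> n A" and cA: "closedin (cart_topology n) A" and neA: "A \<noteq> {}"
    and df: "dfun n (\<lambda>x. if x \<in> A then f x else 0)"
    and cf: "continuous_map (subtopology (cart_topology n) A) euclidean f"
    and nonneg: "\<And>x. 0 \<le> f x"
  shows "\<exists>F. dfun n F \<and> continuous_map (cart_topology n) euclidean F \<and> (\<forall>x\<in>A. F x = f x)"
proof -
  note set = dA cA neA
  note sub = A_subset[OF set]
  let ?d = "gsetdist n A"
  define N where "N x t \<longleftrightarrow> 0 < t \<and> (\<exists>a\<in>A. f a < t \<and> gdist n x a < \<Lambda> (?d x) t)" for x t
  define F where "F x = (if x \<in> A then f x else glb {t. N x t})" for x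
  have N_mono: "N x u" if "N x t" "t \<le> u" "x \<in> cart_power n" "x \<notin> A" for x t u
  proof -
    have "\<Lambda> (?d x) t \<le> \<Lambda> (?d x) u"
      using modulusD(4)[OF mod gsetdist_pos[OF set that(3,4)], of t u] that(1,2)
      by (cases "t = u") (auto simp: N_def le_less)
    then show ?thesis using that(1,2) unfolding N_def by (meson order.strict_trans2)
  qed
  have N_ex: "\<exists>t. N x t" if x: "x \<in> cart_power n" "x \<notin> A" for x
  proof -
    obtain t0 :: 'a where t0: "0 < t0" by (rule exists_pos)
    have pos: "0 < ?d x" by (rule gsetdist_pos[OF set x])
    \<comment> \<open>The search radius exceeds the distance to \<open>A\<close>, so some
      \<open>a\<close> is found; raising the threshold above \<open>f a\<close> only enlarges the
      radius.\<close>
    obtain a where a: "a \<in> A" "gdist n x a < \<Lambda> (?d x) t0"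
      using modulusD(2)[OF mod pos t0] gsetdist_less_iff[OF set] by blast
    obtain t where t: "max t0 (f a) < t" using gt_ex by blast
    then have "\<Lambda> (?d x) t0 < \<Lambda> (?d x) t" using modulusD(4)[OF mod pos t0] by simp
    then show ?thesis using a t t0 unfolding N_def by (intro exI[of _ t]) force
  qed
  have dN: "dpred (\<lambda>v. N (restrict (x v) {..<n}) (v j))" if x: "\<And>i. i < n \<Longrightarrow> dterm (\<lambda>v. x v i)" for x j
  proof -
    have x': "dterm (\<lambda>v. x (\<lambda>k. v (\<sigma> k)) i)" if "i < n" for i \<sigma>
      by (rule definable_term_shift[OF x[OF that]])
    have eq: "N x t \<longleftrightarrow> 0 < t \<and> (\<exists>a\<in>cart_power n. a \<in> A \<and> (if a \<in> A then f a else 0) < t \<and>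
        gdist n x a < \<Lambda> (?d x) t)" for x t
      using sub by (auto simp: N_def)
    show ?thesis
      unfolding eq
      by (intro definable_intros definable_pred_ex_cart definable_comp[OF dA] dterm_restrict x x'
          dfun_comp[OF df, simplified] definable_term_binary[OF modulusD(1)[OF mod]] dterm_gsetdist[OF set])
  qed
  have dF: "dfun n F"
  proof -
    have "F x = (if x \<in> A then (if x \<in> A then f x else 0) else glb {t. N x t})" for x
      by (simp add: F_def)
    moreover have "dterm (\<lambda>v. if restrict v {..<n} \<in> A then (if restrict v {..<n} \<in> A then f (restrict v {..<n}) else 0)
        else glb {t. N (restrict v {..<n}) t})"
      by (intro definable_term_if definable_pred_restrict_mem[OF dA] df[unfolded dfun_def] dterm_glb dN definable_term_var)
    ultimately show ?thesis unfolding dfun_def by simp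
  qed
  have glb: "is_glb {t. N x t} (F x)" if x: "x \<in> cart_power n" "x \<notin> A" for x
  proof -
    have "(\<lambda>k\<in>{..<n}. x k) = x" using PiE_restrict[OF x(1)] by simp
    moreover have "dpred (\<lambda>v. N (\<lambda>k\<in>{..<n}. x k) (v 0))"
      by (intro dN definable_term_const)
    ultimately have "dpred (\<lambda>v. N x (v 0))" by simp
    moreover obtain t where "N x t" using N_ex[OF x] by blast
    moreover have "0 \<le> t" if "N x t" for t using that by (simp add: N_def less_imp_le)
    ultimately have "is_glb {t. N x t} (glb {t. N x t})" by (rule is_glb_glb)
    then show ?thesis using x by (simp add: F_def)
  qed
  have F_less: "\<exists>t<u. N x t" if "F x < u" "x \<in> cart_power n" "x \<notin> A" for x u
    using is_glb_less_iff[OF glb[OF that(2,3)]] that(1) by blast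
  have F_le: "F x \<le> t" if "N x t" "x \<in> cart_power n" "x \<notin> A" for x t
    using glb[OF that(2,3)] that(1) by (simp add: is_glb_def)
  have F_ge: "u \<le> F x" if "\<not> N x u" "x \<in> cart_power n" "x \<notin> A" for x u
    using F_less[of x u] N_mono[of x _ u] that by (meson less_imp_le not_le)
  have F_nonneg: "0 \<le> F x" if "x \<in> cart_power n" for x
    using nonneg F_ge[of x 0] that by (cases "x \<in> A") (auto simp: F_def N_def)
  have boundary: "\<exists>r>0. \<forall>y\<in>cart_power n. gdist n y x < r \<longrightarrow> F y \<in> {l<..<u}"
    if x: "x \<in> A" and lu: "l < f x" "f x < u" for x l u
  proof -
    obtain l' where l': "l < l'" "l' < f x" using dense lu(1) by blast
    obtain u' where u': "f x < u'" "u' < u" using dense lu(2) by blast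
    have u'_pos: "0 < u'" using nonneg[of x] u'(1) by simp
    obtain r where r: "0 < r" "\<And>y. y \<in> A \<Longrightarrow> gdist n y x < r \<Longrightarrow> f y \<in> {l'<..<u'}"
      using continuous_map_ball[OF cf sub x, of "{l'<..<u'}"] l' u' by auto
    \<comment> \<open>Whatever is found from \<open>y\<close> lies within twice its distance to
      \<open>A\<close>, hence within \<open>d + d \<le> r2\<close> of \<open>y\<close>, and
      \<open>y\<close> is within \<open>r2\<close> of \<open>x\<close>. So only points within
      \<open>r\<close> of \<open>x\<close> are found, where \<open>f\<close> lies between
      \<open>l'\<close> and \<open>u'\<close>.\<close>
    obtain r2 where r2: "0 < r2" "r2 + r2 \<le> r" using half_pos[OF r(1)] .
    obtain d where d: "0 < d" "d + d \<le> r2" using half_pos[OF r2(1)] .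
    have rl: "l' < f y" and ru: "f y < u'" if "y \<in> A" "gdist n y x < r" for y
      using r(2)[OF that] by auto
    have "r2 < r2 + r2" "d < d + d" using r2(1) d(1) by simp_all
    then have "d < r2" "d < r" using r2(2) d(2) by order+
    have "F y \<in> {l<..<u}" if y: "y \<in> cart_power n" "gdist n y x < d" for y
    proof (cases "y \<in> A")
      case True
      have yr: "gdist n y x < r" using y(2) \<open>d < r\<close> by order
      have "l < f y" "f y < u" using rl[OF True yr] ru[OF True yr] l' u' by order+
      then show ?thesis using True by (simp add: F_def)
    next
      case False
      have pos: "0 < ?d y" by (rule gsetdist_pos[OF set y(1) False])
      have dy: "?d y < d" using gsetdist_le[OF set x, of y] y(2) by simp
      have near: "gdist n a x < r" if a: "gdist n y a < \<Lambda> (?d y) t" "0 < t" for a t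
      proof -
        have "gdist n y a < ?d y + ?d y" using a(1) modulusD(3)[OF mod pos a(2)] by order
        also have "\<dots> < d + d" by (rule ab.add_strict_mono[OF dy dy])
        finally have "gdist n a y < r2" unfolding gdist_commute[of n a y] using d(2) by order
        moreover have "gdist n y x < r2" using y(2) \<open>d < r2\<close> by order
        ultimately have "gdist n a y + gdist n y x < r2 + r2" by (rule ab.add_strict_mono)
        then show ?thesis using gdist_triangle[of n a x y] r2(2) by order
      qed
      have "\<not> N y l'"
      proof
        assume "N y l'"
        then obtain a where a: "0 < l'" "a \<in> A" "f a < l'" "gdist n y a < \<Lambda> (?d y) l'"
          unfolding N_def by blast
        then show False using rl[OF a(2) near[OF a(4,1)]] by order
      qed
      then have "l' \<le> F y" using F_ge y False by blast
      moreover have "N y u'"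
      proof -
        obtain a where a: "a \<in> A" "gdist n y a < \<Lambda> (?d y) u'"
          using modulusD(2)[OF mod pos u'_pos] gsetdist_less_iff[OF set] by blast
        then have "f a < u'" using ru[OF a(1) near] u'_pos by blast
        then show ?thesis using a u'_pos unfolding N_def by blast
      qed
      then have "F y \<le> u'" using F_le y False by blast
      ultimately have "l < F y" "F y < u" using l' u' by order+
      then show ?thesis by simp
    qed
    then show ?thesis using d(1) by blast
  qed
  have upper: "\<exists>r>0. \<forall>y\<in>cart_power n. gdist n y x < r \<longrightarrow> F y < u"
    if x: "x \<in> cart_power n" "x \<notin> A" and u: "F x < u" for x u
  proof -
    obtain t where t: "t < u" "N x t" using F_less[OF u x] by blast
    then obtain a where a: "a \<in> A" "f a < t" "gdist n x a < \<Lambda> (?d x) t" and "0 < t"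
      unfolding N_def by blast
    \<comment> \<open>The same witness \<open>a\<close> serves all nearby points: their distance to
      \<open>A\<close> stays at least \<open>\<delta>\<close>, and the slack between
      \<open>gdist n x a\<close> and \<open>\<Lambda> \<delta> t\<close> absorbs the move from
      \<open>x\<close> to \<open>y\<close>.\<close>
    obtain \<delta> where \<delta>: "0 < \<delta>" "\<delta> < ?d x" "gdist n x a < \<Lambda> \<delta> t"
      using modulusD(6)[OF mod gsetdist_pos[OF set x] \<open>0 < t\<close> a(3)] by blast
    obtain r0 where r0: "0 < r0" "\<And>y. y \<in> cart_power n \<Longrightarrow> gdist n y x < r0 \<Longrightarrow> y \<notin> A"
      using complement_radius[OF set x] by blast
    define r where "r = min r0 (min (?d x - \<delta>) (\<Lambda> \<delta> t - gdist n x a))"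
    have "F y < u" if y: "y \<in> cart_power n" "gdist n y x < r" for y
    proof -
      have "y \<notin> A" using r0(2) y by (simp add: r_def)
      have "\<delta> + gdist n y x < ?d x" using y(2) by (simp add: r_def ab.less_diff_eq add_commute)
      also have "\<dots> \<le> ?d y + gdist n y x" using gsetdist_triangle[OF set, of x y] by (simp add: gdist_commute)
      finally have "\<delta> \<le> ?d y" by simp
      then have "\<Lambda> \<delta> t \<le> \<Lambda> (?d y) t" using modulusD(5)[OF mod \<delta>(1)] \<open>0 < t\<close> by blast
      moreover have "gdist n y x + gdist n x a < \<Lambda> \<delta> t" using y(2) by (simp add: r_def ab.less_diff_eq)
      ultimately have "gdist n y a < \<Lambda> (?d y) t"
        using gdist_triangle[of n y a x] by order
      then have "N y t" using a \<open>0 < t\<close> unfolding N_def by blast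
      from F_le[OF this y(1) \<open>y \<notin> A\<close>] show ?thesis using t(1) by order
    qed
    moreover have "0 < r" using r0(1) \<delta> by (simp add: r_def ab.less_diff_eq)
    ultimately show ?thesis by blast
  qed
  have lower: "\<exists>r>0. \<forall>y\<in>cart_power n. gdist n y x < r \<longrightarrow> u < F y"
    if x: "x \<in> cart_power n" "x \<notin> A" and u: "u < F x" for x u
  proof (cases "u < 0")
    case True
    obtain r :: 'a where "0 < r" by (rule exists_pos)
    moreover have "u < F y" if "y \<in> cart_power n" for y using F_nonneg[OF that] True by order
    ultimately show ?thesis by blast
  next
    case False
    \<comment> \<open>Two thresholds are taken between \<open>u\<close> and \<open>F x\<close>.
      Failure at \<open>t'\<close> keeps all points with \<open>f a < t'\<close> at distance at
      least \<open>\<Lambda> (?d x) t'\<close>, while the search at \<open>t\<close> has a strictly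
      smaller radius. This gap replaces compactness: it makes the search at \<open>t\<close> fail
      from every nearby \<open>y\<close>.\<close>
    obtain t where t: "u < t" "t < F x" using dense[OF u] by blast
    obtain t' where t': "t < t'" "t' < F x" using dense[OF t(2)] by blast
    have "0 < t" using False t(1) by order
    have "\<not> N x t'"
    proof
      assume "N x t'"
      from F_le[OF this x] show False using t'(2) by order
    qed
    have far: "\<Lambda> (?d x) t' \<le> gdist n x a" if "a \<in> A" "f a < t'" for a
    proof -
      have "0 < t'" using \<open>0 < t\<close> t'(1) by order
      then have "\<not> gdist n x a < \<Lambda> (?d x) t'" using \<open>\<not> N x t'\<close> that unfolding N_def by blast
      then show ?thesis by simp
    qed
    have "\<Lambda> (?d x) t < \<Lambda> (?d x) t'"
      by (rule modulusD(4)[OF mod gsetdist_pos[OF set x] \<open>0 < t\<close> t'(1)])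
    then obtain \<delta> where \<delta>: "?d x < \<delta>" "\<Lambda> \<delta> t < \<Lambda> (?d x) t'"
      using modulusD(7)[OF mod gsetdist_pos[OF set x] \<open>0 < t\<close>] by blast
    obtain r0 where r0: "0 < r0" "\<And>y. y \<in> cart_power n \<Longrightarrow> gdist n y x < r0 \<Longrightarrow> y \<notin> A"
      using complement_radius[OF set x] by blast
    define r where "r = min r0 (min (\<delta> - ?d x) (\<Lambda> (?d x) t' - \<Lambda> \<delta> t))"
    have "u < F y" if y: "y \<in> cart_power n" "gdist n y x < r" for y
    proof -
      have "y \<notin> A" using r0(2) y by (simp add: r_def)
      have "?d y \<le> ?d x + gdist n y x" by (rule gsetdist_triangle[OF set])
      also have "\<dots> < \<delta>" using y(2) by (simp add: r_def ab.less_diff_eq add_commute)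
      finally have "\<Lambda> (?d y) t \<le> \<Lambda> \<delta> t"
        using modulusD(5)[OF mod gsetdist_pos[OF set y(1) \<open>y \<notin> A\<close>]] \<open>0 < t\<close> by (simp add: less_imp_le)
      moreover have "\<Lambda> \<delta> t < gdist n y a" if a: "a \<in> A" "f a < t" for a
      proof -
        have "f a < t'" using a(2) t'(1) by order
        have "gdist n y x + \<Lambda> \<delta> t < \<Lambda> (?d x) t'" using y(2) by (simp add: r_def ab.less_diff_eq)
        also have "\<Lambda> (?d x) t' \<le> gdist n x a" using a(1) \<open>f a < t'\<close> by (rule far)
        also have "\<dots> \<le> gdist n y x + gdist n y a"
          using gdist_triangle[of n x a y] by (simp add: gdist_commute)
        finally show ?thesis by simp
      qed
      ultimately have "\<not> N y t" unfolding N_def by force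
      then have "t \<le> F y" using F_ge y(1) \<open>y \<notin> A\<close> by blast
      then show ?thesis using t(1) by simp
    qed
    moreover have "0 < r" using r0(1) \<delta> by (simp add: r_def ab.less_diff_eq)
    ultimately show ?thesis by blast
  qed
  have "continuous_map (cart_topology n) euclidean F"
  proof (rule continuous_map_into_order_topologyI)
    fix u :: 'a
    have "\<exists>r>0. \<forall>y\<in>cart_power n. gdist n y x < r \<longrightarrow> F y < u" if x: "x \<in> cart_power n" "F x < u" for x
    proof (cases "x \<in> A")
      case True
      obtain l where "l < f x" using lt_ex by blast
      moreover have "f x < u" using x(2) True by (simp add: F_def)
      ultimately show ?thesis using boundary[OF True] by (meson greaterThanLessThan_iff)
    qed (use upper x in blast)
    then show "openin (cart_topology n) {x \<in> topspace (cart_topology n). F x < u}"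
      unfolding openin_cart_iff by auto
    have "\<exists>r>0. \<forall>y\<in>cart_power n. gdist n y x < r \<longrightarrow> u < F y" if x: "x \<in> cart_power n" "u < F x" for x
    proof (cases "x \<in> A")
      case True
      obtain l where "f x < l" using gt_ex by blast
      moreover have "u < f x" using x(2) True by (simp add: F_def)
      ultimately show ?thesis using boundary[OF True] by (meson greaterThanLessThan_iff)
    qed (use lower x in blast)
    then show "openin (cart_topology n) {x \<in> topspace (cart_topology n). u < F x}"
      unfolding openin_cart_iff by auto
  qed
  moreover have "\<forall>x\<in>A. F x = f x" by (simp add: F_def)
  ultimately show ?thesis using dF by blast
qed


section \<open>Differences of continuous functions and reduction to the nonnegative case\<close>

lemma openin_less_preimage:
  fixes f :: "'b \<Rightarrow> 'a"
  assumes "continuous_map X euclidean f"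
  shows "openin X {x \<in> topspace X. f x < t}" "openin X {x \<in> topspace X. t < f x}"
  using openin_continuous_map_preimage[OF assms, of "{..<t}"]
    openin_continuous_map_preimage[OF assms, of "{t<..}"] by simp_all

text \<open>By density, bounds \<open>p\<close> and \<open>q\<close> for the two functions can be
  squeezed in, so the preimage of a ray is a union of intersections of preimages of rays.\<close>

lemma continuous_map_group_diff:
  fixes f g :: "'b \<Rightarrow> 'a"
  assumes f: "continuous_map X euclidean f" and g: "continuous_map X euclidean g"
  shows "continuous_map X euclidean (\<lambda>x. f x - g x)"
proof (rule continuous_map_into_order_topologyI)
  fix t :: 'a
  have "f x - g x < t \<longleftrightarrow> (\<exists>p. \<exists>q. p - q < t \<and> f x < p \<and> q < g x)" for x
  proof
    assume "f x - g x < t"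
    then obtain p where p: "f x < p" "p < t + g x" using dense by (auto simp: ab.diff_less_eq)
    then have "p - t < g x" by (simp add: ab.diff_less_eq add_commute)
    then obtain q where "p - t < q" "q < g x" using dense by blast
    moreover from this have "p - q < t" by (simp add: ab.diff_less_eq add_commute)
    ultimately show "\<exists>p. \<exists>q. p - q < t \<and> f x < p \<and> q < g x" using p by blast
  next
    assume "\<exists>p. \<exists>q. p - q < t \<and> f x < p \<and> q < g x"
    then obtain p q where pq: "p - q < t" "f x < p" "q < g x" by blast
    then have "f x - g x < p - q" by (intro ab.diff_strict_mono)
    then show "f x - g x < t" using pq(1) by order
  qed
  then have "{x \<in> topspace X. f x - g x < t} =
      (\<Union>p. \<Union>q\<in>{q. p - q < t}. {x \<in> topspace X. f x < p} \<inter> {x \<in> topspace X. q < g x})" by auto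
  then show "openin X {x \<in> topspace X. f x - g x < t}"
    using openin_less_preimage[OF f] openin_less_preimage[OF g] by (auto intro!: openin_Union)
  have "t < f x - g x \<longleftrightarrow> (\<exists>p. \<exists>q. t < p - q \<and> p < f x \<and> g x < q)" for x
  proof
    assume "t < f x - g x"
    then obtain p where p: "t + g x < p" "p < f x" using dense by (auto simp: ab.less_diff_eq)
    then have "g x < p - t" by (simp add: ab.less_diff_eq add_commute)
    then obtain q where "g x < q" "q < p - t" using dense by blast
    moreover from this have "t < p - q" by (simp add: ab.less_diff_eq add_commute)
    ultimately show "\<exists>p. \<exists>q. t < p - q \<and> p < f x \<and> g x < q" using p by blast
  next
    assume "\<exists>p. \<exists>q. t < p - q \<and> p < f x \<and> g x < q"
    then obtain p q where pq: "t < p - q" "p < f x" "g x < q" by blast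
    then have "p - q < f x - g x" by (intro ab.diff_strict_mono)
    then show "t < f x - g x" using pq(1) by order
  qed
  then have "{x \<in> topspace X. t < f x - g x} =
      (\<Union>p. \<Union>q\<in>{q. t < p - q}. {x \<in> topspace X. p < f x} \<inter> {x \<in> topspace X. g x < q})" by auto
  then show "openin X {x \<in> topspace X. t < f x - g x}"
    using openin_less_preimage[OF f] openin_less_preimage[OF g] by (auto intro!: openin_Union)
qed

lemma continuous_map_max_zero:
  fixes f :: "'b \<Rightarrow> 'a"
  assumes f: "continuous_map X euclidean f"
  shows "continuous_map X euclidean (\<lambda>x. max (f x) 0)"
proof (rule continuous_map_into_order_topologyI)
  fix t :: 'a
  show "openin X {x \<in> topspace X. max (f x) 0 < t}"
    using openin_less_preimage(1)[OF f, of t] by (cases "0 < t") simp_all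
  show "openin X {x \<in> topspace X. t < max (f x) 0}"
    using openin_less_preimage(2)[OF f, of t] by (cases "t < 0") (simp_all add: less_max_iff_disj)
qed

text \<open>Positive and negative parts are extended separately, and the extensions are
  subtracted.\<close>

lemma tietze_of_modulus:
  assumes mod: "modulus \<Lambda>"
  shows "definable_Tietze \<M>"
  unfolding definable_Tietze_def
proof (intro allI impI, elim conjE)
  fix n A f
  assume dA: "definable \<M> n A" and cA: "closedin (cart_topology n) A"
    and df: "definable_fun \<M> n A f"
    and cf: "continuous_map (subtopology (cart_topology n) A) euclidean f"
  have "\<exists>F. dfun n F \<and> continuous_map (cart_topology n) euclidean F \<and> (\<forall>x\<in>A. F x = f x)"
  proof (cases "A = {}")
    case True
    then show ?thesis
      by (intro exI[of _ "\<lambda>_. 0"]) (simp add: dfun_def definable_term_const)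
  next
    case False
    define f0 where "f0 x = (if x \<in> A then f x else 0)" for x
    have df0: "dfun n f0" unfolding f0_def by (rule dfun_of_definable_fun[OF dA df])
    have cf0: "continuous_map (subtopology (cart_topology n) A) euclidean f0"
      by (rule continuous_map_eq[OF cf]) (simp add: f0_def)
    have "continuous_map (subtopology (cart_topology n) A) euclidean (\<lambda>x. 0 - f0 x)"
      by (rule continuous_map_group_diff[OF _ cf0]) simp
    then have cm0: "continuous_map (subtopology (cart_topology n) A) euclidean (\<lambda>x. - f0 x)"
      by simp
    have "(\<lambda>x. if x \<in> A then max (f0 x) 0 else 0) = (\<lambda>x. max (f0 x) 0)"
      "(\<lambda>x. if x \<in> A then max (- f0 x) 0 else 0) = (\<lambda>x. max (- f0 x) 0)"
      by (auto simp: f0_def)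
    then have dp: "dfun n (\<lambda>x. if x \<in> A then max (f0 x) 0 else 0)"
      and dm: "dfun n (\<lambda>x. if x \<in> A then max (- f0 x) 0 else 0)"
      using df0 by (simp_all add: dfun_def definable_intros)
    obtain F where F: "dfun n F" "continuous_map (cart_topology n) euclidean F"
        "\<forall>x\<in>A. F x = max (f0 x) 0"
      using tietze_nonneg[OF mod dA cA False dp continuous_map_max_zero[OF cf0]] by auto
    obtain G where G: "dfun n G" "continuous_map (cart_topology n) euclidean G"
        "\<forall>x\<in>A. G x = max (- f0 x) 0"
      using tietze_nonneg[OF mod dA cA False dm continuous_map_max_zero[OF cm0]] by auto
    have "max a 0 - max (- a) 0 = a" for a :: 'a
      by (cases a "0 :: 'a" rule: linorder_cases) (simp_all add: max_absorb1 max_absorb2 less_imp_le)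
    then have "\<forall>x\<in>A. F x - G x = f x" using F(3) G(3) by (simp add: f0_def)
    moreover have "dfun n (\<lambda>x. F x - G x)"
      using F(1) G(1) unfolding dfun_def by (rule dterm_diff)
    ultimately show ?thesis using continuous_map_group_diff[OF F(2) G(2)] by blast
  qed
  then show "\<exists>F. definable_fun \<M> n (cart_power n) F \<and>
      continuous_map (cart_topology n) euclidean F \<and> (\<forall>x\<in>A. F x = f x)"
    using definable_fun_of_dfun by blast
qed


section \<open>Poles and definable bijections\<close>

lemma restrict_mem_line_set: "restrict v {..<1} \<in> line_set I \<longleftrightarrow> v 0 \<in> I"
  by (simp add: line_set_def)

lemma definable_bij_of_pole:
  assumes "pole \<tau> e"
  shows "\<exists>f I J. bounded_interval I \<and> unbounded_interval J \<and> definable_bij \<M> f I J"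
proof (intro exI conjI)
  have d: "dterm (\<lambda>v. \<tau> (v 0))" and e: "0 < e"
    and decr: "\<And>x y. 0 < x \<Longrightarrow> x < y \<Longrightarrow> y < e \<Longrightarrow> \<tau> y < \<tau> x" and img: "\<tau> ` {0<..<e} = {0<..}"
    using assms unfolding pole_def by simp_all
  show "bounded_interval {0<..<e}" using e unfolding bounded_interval_def by blast
  show "unbounded_interval {0::'a<..}" unfolding unbounded_interval_def by blast
  have "inj_on \<tau> {0<..<e}"
  proof (rule linorder_inj_onI)
    show "\<tau> x \<noteq> \<tau> y" if "x < y" "x \<in> {0<..<e}" "y \<in> {0<..<e}" for x y
      using decr[of x y] that by auto
  qed auto
  moreover have "dpred (\<lambda>v. v 0 \<in> {0<..<e} \<and> v 1 = \<tau> (v 0))"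
    unfolding greaterThanLessThan_iff by (intro definable_intros definable_term_unary[OF d])
  from definable_Collect[OF this, of 2]
  have "definable_fun \<M> 1 (line_set {0<..<e}) (\<lambda>x. \<tau> (x 0))"
    unfolding definable_fun_def restrict_mem_line_set by (simp add: numeral_2_eq_2)
  ultimately show "definable_bij \<M> \<tau> {0<..<e} {0<..}"
    using img unfolding definable_bij_def bij_betw_def by simp
qed

text \<open>An unbounded interval is unbounded above or below, so either \<open>f\<close> or its
  negative, continued by \<open>0\<close>, is unbounded above on the bounded set
  \<open>I\<close>.\<close>

lemma pole_of_definable_bij:
  assumes I: "bounded_interval I" and J: "unbounded_interval J" and f: "definable_bij \<M> f I J"
  shows "\<exists>\<tau> e. pole \<tau> e"
proof -
  have dI: "dpred (\<lambda>v. v 0 \<in> I)"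
    using I unfolding bounded_interval_def by (elim exE conjE disjE) (simp_all add: definable_intros)
  obtain p q where "I = {p<..<q} \<or> I = {p..<q} \<or> I = {p<..q} \<or> I = {p..q}"
    using I unfolding bounded_interval_def by blast
  then have "I \<subseteq> {p..q}" by (elim disjE) (simp_all add: subset_iff less_imp_le)
  then have pq: "\<And>y. y \<in> I \<Longrightarrow> p \<le> y" "\<And>y. y \<in> I \<Longrightarrow> y \<le> q" by auto
  have "definable \<M> 1 (line_set I)"
    using definable_Collect[OF dI, of 1] unfolding line_set_def .
  then have "dfun 1 (\<lambda>x. if x \<in> line_set I then f (x 0) else 0)"
    using f unfolding definable_bij_def by (intro dfun_of_definable_fun) auto
  then have dg: "dterm (\<lambda>v. if v 0 \<in> I then f (v 0) else 0)"
    unfolding dfun_def restrict_mem_line_set by (simp only: restrict_apply lessThan_iff zero_less_one if_True)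
  have img: "f ` I = J" using f unfolding definable_bij_def bij_betw_def by blast
  have "(\<forall>t. \<exists>j\<in>J. t < j) \<or> (\<forall>t. \<exists>j\<in>J. j < t)"
  proof -
    have "(\<exists>a. {a<..} \<subseteq> J) \<or> (\<exists>b. {..<b} \<subseteq> J)"
      using J unfolding unbounded_interval_def
      by (elim disjE exE; simp add: subset_iff; blast intro: less_imp_le)
    then consider a where "{a<..} \<subseteq> J" | b where "{..<b} \<subseteq> J" by blast
    then show ?thesis
    proof cases
      case 1
      have "\<exists>j\<in>J. t < j" for t using gt_ex[of "max a t"] subsetD[OF 1] by auto
      then show ?thesis by blast
    next
      case 2
      have "\<exists>j\<in>J. j < t" for t using lt_ex[of "min b t"] subsetD[OF 2] by auto
      then show ?thesis by blast
    qed
  qed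
  then show ?thesis
  proof
    assume "\<forall>t. \<exists>j\<in>J. t < j"
    then have unb: "\<exists>y. y \<in> I \<and> t < (if y \<in> I then f y else 0)" for t
      unfolding img[symmetric] by auto
    show ?thesis
      by (rule ex_pole_of_unbounded_fun[where S = "\<lambda>y. y \<in> I" and p = p and q = q and
          g = "\<lambda>y. if y \<in> I then f y else 0", OF dI dg _ _ unb]) (simp_all add: pq)
  next
    assume un: "\<forall>t. \<exists>j\<in>J. j < t"
    have unb: "\<exists>y. y \<in> I \<and> t < - (if y \<in> I then f y else 0)" for t
    proof -
      obtain y where "y \<in> I" "f y < - t" using un[rule_format, of "- t"] unfolding img[symmetric] by auto
      then show ?thesis by (intro exI[of _ y]) (simp add: ab.less_minus_iff)
    qed
    show ?thesis
      by (rule ex_pole_of_unbounded_fun[where S = "\<lambda>y. y \<in> I" and p = p and q = q and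
          g = "\<lambda>y. - (if y \<in> I then f y else 0)", OF dI dterm_uminus[OF dg] _ _ unb]) (simp_all add: pq)
  qed
qed

section \<open>From extensions to poles\<close>

lemma pole_of_tietze:
  assumes tietze: "definable_Tietze \<M>"
  shows "\<exists>\<tau> e. pole \<tau> e"
proof (rule ccontr)
  assume no_pole: "\<nexists>\<tau> e. pole \<tau> e"
  have bdd: "\<exists>K. \<forall>y. S y \<longrightarrow> g y \<le> K"
    if "dpred (\<lambda>v. S (v 0))" "dterm (\<lambda>v. g (v 0))" "\<And>y. S y \<Longrightarrow> p \<le> y" "\<And>y. S y \<Longrightarrow> y \<le> q" for S g p q
    using ex_pole_of_unbounded_fun[OF that] no_pole by (metis not_le)
  obtain u :: 'a where u: "0 < u" by (rule exists_pos)
  define A where "A = {x \<in> cart_power 2. x 1 = (0::'a) \<or> x 1 = u}"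
  define f where "f x = (if x 1 = (0::'a) then 0 else x 0)" for x :: "nat \<Rightarrow> 'a"
  have proj: "continuous_map (cart_topology 2) euclidean (\<lambda>x. x i :: 'a)" if "i < 2" for i
    using that by (intro continuous_map_product_projection) simp
  have dA: "definable \<M> 2 A" unfolding A_def by (intro definable_Collect definable_intros)
  have cA: "closedin (cart_topology 2) A"
  proof -
    have "closedin (cart_topology 2) {x \<in> topspace (cart_topology 2). x 1 \<in> {0, u}}"
      by (rule closedin_continuous_map_preimage[OF proj]) auto
    then show ?thesis by (simp add: A_def)
  qed
  have df: "definable_fun \<M> 2 A f"
  proof -
    have "definable \<M> 3 {x \<in> cart_power 3. (x 1 = 0 \<or> x 1 = u) \<and> x 2 = (if x 1 = 0 then 0 else x 0)}"
      by (intro definable_Collect definable_intros)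
    moreover have "{x \<in> cart_power (Suc 2). restrict x {..<2} \<in> A \<and> x 2 = f (restrict x {..<2})} =
        {x \<in> cart_power 3. (x 1 = 0 \<or> x 1 = u) \<and> x 2 = (if x 1 = 0 then 0 else x 0)}"
      by (auto simp: A_def f_def)
    ultimately show ?thesis unfolding definable_fun_def by simp
  qed
  have cf: "continuous_map (subtopology (cart_topology 2) A) euclidean f"
  proof (rule continuous_map_into_order_topologyI)
    fix t :: 'a
    let ?X = "cart_topology 2 :: (nat \<Rightarrow> 'a) topology"
    note open_proj = openin_less_preimage[OF proj]
    have top: "topspace (subtopology ?X A) = A" using closedin_subset[OF cA] by auto
    \<comment> \<open>On \<open>A\<close> the second coordinate is \<open>0\<close> or
      \<open>u\<close>, so \<open>x 1 < u\<close> selects the first line and \<open>0 < x 1\<close>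
      the second, each by an open condition.\<close>
    have less: "f x < t \<longleftrightarrow> (x 1 < u \<and> 0 < t) \<or> (0 < x 1 \<and> x 0 < t)"
      and greater: "t < f x \<longleftrightarrow> (x 1 < u \<and> t < 0) \<or> (0 < x 1 \<and> t < x 0)" if "x \<in> A" for x
      using that u by (cases "x 1 = 0"; simp add: A_def f_def)+
    have "{x \<in> topspace (subtopology ?X A). f x < t} = A \<inter>
        ({x \<in> topspace ?X. x 1 < u \<and> 0 < t} \<union> ({x \<in> topspace ?X. 0 < x 1} \<inter> {x \<in> topspace ?X. x 0 < t}))"
      unfolding top using less closedin_subset[OF cA] by blast
    moreover have "openin ?X {x \<in> topspace ?X. x 1 < u \<and> 0 < t}"
      using open_proj(1)[of 1 u] by (cases "0 < t") simp_all
    then have "openin ?X ({x \<in> topspace ?X. x 1 < u \<and> 0 < t} \<union>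
        ({x \<in> topspace ?X. 0 < x 1} \<inter> {x \<in> topspace ?X. x 0 < t}))"
      using open_proj(2)[of 1 0] open_proj(1)[of 0 t] by (intro openin_Un openin_Int) simp_all
    ultimately show "openin (subtopology ?X A) {x \<in> topspace (subtopology ?X A). f x < t}"
      by (simp only: openin_subtopology_Int2)
    have "{x \<in> topspace (subtopology ?X A). t < f x} = A \<inter>
        ({x \<in> topspace ?X. x 1 < u \<and> t < 0} \<union> ({x \<in> topspace ?X. 0 < x 1} \<inter> {x \<in> topspace ?X. t < x 0}))"
      unfolding top using greater closedin_subset[OF cA] by blast
    moreover have "openin ?X {x \<in> topspace ?X. x 1 < u \<and> t < 0}"
      using open_proj(1)[of 1 u] by (cases "t < 0") simp_all
    then have "openin ?X ({x \<in> topspace ?X. x 1 < u \<and> t < 0} \<union>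
        ({x \<in> topspace ?X. 0 < x 1} \<inter> {x \<in> topspace ?X. t < x 0}))"
      using open_proj(2)[of 1 0] open_proj(2)[of 0 t] by (intro openin_Un openin_Int) simp_all
    ultimately show "openin (subtopology ?X A) {x \<in> topspace (subtopology ?X A). t < f x}"
      by (simp only: openin_subtopology_Int2)
  qed
  obtain F where F: "definable_fun \<M> 2 (cart_power 2) F" "continuous_map (cart_topology 2) euclidean F"
      "\<forall>x\<in>A. F x = f x"
    using tietze[unfolded definable_Tietze_def, rule_format, of 2 A f] dA cA df cf by auto
  define pt where "pt x y = (\<lambda>i\<in>{..<2::nat}. if i = 0 then x else y)" for x y :: 'a
  define H where "H x y = F (pt x y)" for x y
  have pt: "pt x y \<in> cart_power 2" "pt x y 0 = x" "pt x y 1 = y" for x y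
    by (auto simp: pt_def)
  have H0: "H x 0 = 0" and Hu: "H x u = x" for x
    using F(3) pt[of x 0] pt[of x u] u by (auto simp: H_def A_def f_def)
  have dH: "dterm (\<lambda>v. H (s v) (t v))" if "dterm s" "dterm t" for s t
  proof -
    have "definable \<M> 2 (cart_power 2)"
      using definable_Collect[OF definable_pred_const[of \<M> True], of 2] by simp
    moreover have "dterm (\<lambda>v. if i = 0 then s v else t v)" for i :: nat
      using that by (cases "i = 0") simp_all
    ultimately have "dterm (\<lambda>v. if pt (s v) (t v) \<in> cart_power 2 then F (pt (s v) (t v)) else 0)"
      unfolding pt_def using F(1) by (intro dfun_comp dfun_of_definable_fun)
    then show ?thesis by (simp only: H_def pt(1) if_True)
  qed
  note [definable_intros] = dH
  have "continuous_map euclidean (cart_topology 2) (pt x)" for x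
    unfolding continuous_map_componentwise by (auto simp: pt_def)
  then have cH: "continuous_map euclidean euclidean (H x)" for x
    using continuous_map_compose[OF _ F(2)] unfolding H_def comp_def by blast
  \<comment> \<open>\<open>E c y\<close> says that \<open>H(-, y)\<close> is eventually constant
    with value \<open>c\<close>. That value is unique, so the supremum \<open>g y\<close> is a
    definable name for it.\<close>
  define E where "E c y \<longleftrightarrow> (\<exists>x0. \<forall>x. x0 < x \<longrightarrow> H x y = c)" for c y
  have E_unique: "c = c'" if E: "E c y" "E c' y" for c c' y
  proof -
    obtain x0 x1 where x: "\<forall>x. x0 < x \<longrightarrow> H x y = c" "\<forall>x. x1 < x \<longrightarrow> H x y = c'"
      using E unfolding E_def by blast
    obtain x where "max x0 x1 < x" using gt_ex by blast
    then show ?thesis using x by auto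
  qed
  define g where "g y = lub {c. E c y}" for y
  have g: "g y = c" if "E c y" for c y
    unfolding g_def using that E_unique by (intro lub_eq) (auto simp: is_lub_def)
  have "\<exists>K. \<forall>y. (0 \<le> y \<and> y \<le> u \<and> (\<exists>c. E c y)) \<longrightarrow> g y \<le> K"
  proof (rule bdd)
    show "dpred (\<lambda>v. 0 \<le> v 0 \<and> v 0 \<le> u \<and> (\<exists>c. E c (v 0)))" "dterm (\<lambda>v. g (v 0))"
      unfolding g_def E_def by (intro definable_intros)+
  qed auto
  then obtain K where K: "\<forall>y. (0 \<le> y \<and> y \<le> u \<and> (\<exists>c. E c y)) \<longrightarrow> g y \<le> K" ..
  \<comment> \<open>Without a pole the eventual values are bounded by \<open>K\<close>, so
    \<open>c\<close> is none of them; being positive, it also lies above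
    \<open>H x 0 = 0\<close>.\<close>
  obtain c where c: "max K 0 < c" using gt_ex by blast
  have notE: "\<not> E c y" if "0 \<le> y" "y \<le> u" for y
  proof
    assume "E c y"
    then have "g y \<le> K" using K that by blast
    moreover have "K < c" using c by simp
    ultimately show False using g[OF \<open>E c y\<close>] by order
  qed
  \<comment> \<open>Beyond \<open>x0\<close> the function \<open>H(-, y)\<close> stays strictly on
    one side of \<open>c\<close>. The bound \<open>0 \<le> x0\<close> provides the infimum
    \<open>h y\<close>, and boundedness of \<open>h\<close> makes the choice uniform in
    \<open>y\<close>.\<close>
  define D where "D y x0 \<longleftrightarrow> 0 \<le> x0 \<and> ((\<forall>x. x0 < x \<longrightarrow> H x y < c) \<or> (\<forall>x. x0 < x \<longrightarrow> c < H x y))" for y x0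
  have D_ex: "\<exists>x0. D y x0" if y: "0 \<le> y" "y \<le> u" for y
  proof -
    have "dpred (\<lambda>v. H (v 0) y < c)" "dpred (\<lambda>v. H (v 0) y = c)" by (intro definable_intros)+
    note dich = eventually_at_top_dichotomy[OF this(1)] eventually_at_top_dichotomy[OF this(2)]
    have "\<not> (\<exists>x0. \<forall>x>x0. H x y = c)" using notE[OF y] by (simp add: E_def)
    then obtain x1 where x1: "\<forall>x>x1. H x y \<noteq> c" using dich(2) by blast
    from dich(1) show ?thesis
    proof (elim disjE exE)
      fix x0 assume "\<forall>x>x0. H x y < c"
      then show ?thesis by (intro exI[of _ "max x0 0"]) (simp add: D_def)
    next
      fix x0 assume "\<forall>x>x0. \<not> H x y < c"
      then have "\<forall>x. max (max x0 x1) 0 < x \<longrightarrow> c < H x y" using x1 by (simp add: not_less le_less) metis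
      then show ?thesis by (intro exI[of _ "max (max x0 x1) 0"]) (simp add: D_def)
    qed
  qed
  define h where "h y = glb {x0. D y x0}" for y
  have h: "is_glb {x0. D y x0} (h y)" if y: "0 \<le> y" "y \<le> u" for y
  proof -
    obtain x0 where "D y x0" using D_ex[OF y] by blast
    moreover have "dpred (\<lambda>v. D y (v 0))" unfolding D_def by (intro definable_intros)
    moreover have "0 \<le> x0" if "D y x0" for x0 using that by (simp add: D_def)
    ultimately show ?thesis unfolding h_def by (intro is_glb_glb)
  qed
  have "\<exists>K. \<forall>y. (0 \<le> y \<and> y \<le> u) \<longrightarrow> h y \<le> K"
  proof (rule bdd)
    show "dpred (\<lambda>v. 0 \<le> v 0 \<and> v 0 \<le> u)" "dterm (\<lambda>v. h (v 0))"
      unfolding h_def D_def by (intro definable_intros)+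
  qed auto
  then obtain X where "\<forall>y. (0 \<le> y \<and> y \<le> u) \<longrightarrow> h y \<le> X" ..
  then have X: "h y \<le> X" if "0 \<le> y" "y \<le> u" for y using that by simp
  \<comment> \<open>Exceeding \<open>X\<close> decides the side of \<open>c\<close> for all
    \<open>y\<close> at once; exceeding \<open>c\<close> puts \<open>H x u = x\<close> above
    it.\<close>
  obtain x where x: "max X c < x" using gt_ex by blast
  have ne: "H x y \<noteq> c" if y: "0 \<le> y" "y \<le> u" for y
  proof -
    have "X < x" using x by simp
    then have "h y < x" using X[OF y] by order
    then obtain x0 where "D y x0" "x0 < x" using is_glb_less_iff[OF h[OF y]] by blast
    then show ?thesis unfolding D_def by auto
  qed
  text \<open>This contradicts the intermediate value theorem for \<open>H x\<close> on \<open>[0, u]\<close>.\<close>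
  have dS: "dpred (\<lambda>v. 0 \<le> v 0 \<and> v 0 \<le> u \<and> H x (v 0) < c)" by (intro definable_intros)
  have S0: "0 \<le> (0::'a) \<and> 0 \<le> u \<and> H x 0 < c" using u c H0 by simp
  define s where "s = lub {y. 0 \<le> y \<and> y \<le> u \<and> H x y < c}"
  have s: "is_lub {y. 0 \<le> y \<and> y \<le> u \<and> H x y < c} s"
    unfolding s_def by (rule is_lub_lub[where u = u, OF dS S0]) simp
  have s_ivl: "0 \<le> s" "s \<le> u"
    using is_lub_upper[OF s, of 0] S0 is_lub_least[OF s, of u] by simp_all
  consider "H x s < c" | "c < H x s" using ne[OF s_ivl] by (meson linorder_neqE)
  then show False
  proof cases
    case 1
    then have "s < u" using s_ivl Hu[of x] x by (cases "s = u") auto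
    moreover have "open {y. H x y < c}" using openin_less_preimage(1)[OF cH, of x c] by simp
    ultimately obtain b where b: "s < b" "{s..<b} \<subseteq> {y. H x y < c}"
      using open_right[of "{y. H x y < c}" s u] 1 by auto
    obtain y where y: "s < y" "y < min b u" using dense[of s "min b u"] b(1) \<open>s < u\<close> by auto
    have "y \<in> {y. H x y < c}" using y by (intro subsetD[OF b(2)]) auto
    then have "0 \<le> y \<and> y \<le> u \<and> H x y < c" using y s_ivl by auto
    then have "y \<le> s" using is_lub_upper[OF s] by simp
    then show False using y(1) by simp
  next
    case 2
    then have "0 < s" using s_ivl H0[of x] c by (cases "s = 0") auto
    moreover have "open {y. c < H x y}" using openin_less_preimage(2)[OF cH, of c x] by simp
    ultimately obtain b where b: "b < s" "{b<..s} \<subseteq> {y. c < H x y}"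
      using open_left[of "{y. c < H x y}" s 0] 2 by auto
    have "s \<le> b"
    proof (rule is_lub_least[OF s])
      fix y assume y: "y \<in> {y. 0 \<le> y \<and> y \<le> u \<and> H x y < c}"
      then have "y \<le> s" by (rule is_lub_upper[OF s])
      show "y \<le> b"
      proof (rule ccontr)
        assume "\<not> y \<le> b"
        then have "y \<in> {y. c < H x y}" using b(2) \<open>y \<le> s\<close> by (intro subsetD[OF b(2)]) simp
        then show False using y by auto
      qed
    qed
    then show False using b(1) by simp
  qed
qed

end

theorem theorem6p4:
  fixes \<M> :: "('f, 'r, 'a::{linordered_group_add, dense_linorder, no_bot, no_top, linorder_topology}) fo_structure"
  assumes "expands_ordered_group \<M>"
    and "o_minimal \<M>"
  shows "(\<exists>f I J. bounded_interval I \<and> unbounded_interval J \<and> definable_bij \<M> f I J)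
         \<longleftrightarrow> definable_Tietze \<M>"
proof -
  interpret o_minimal_group \<M>
    using assms by unfold_locales
  show ?thesis
    using pole_of_definable_bij ex_modulus tietze_of_modulus pole_of_tietze definable_bij_of_pole by metis
qed

end
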